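(* The problem $\alpha$-$\textsc{Stability}$ is in $\mathrm{P}$ for co-graphs; that is, there is a deterministic polynomial-time algorithm that, given any co-graph $G$, decides whether $G$ is $\alpha$-stable.
   Context: Graphs are finite, undirected, simple, without loops. Co-graphs are defined recursively: a single-vertex graph $(\{v\},\emptyset)$ is a co-graph; if $G_1$ and $G_2$ are (vertex-disjoint) co-graphs, then so are their disjoint union $G_1\cup G_2$ and their join $G_1+G_2$ (the disjoint union together with all edges between $V(G_1)$ and $V(G_2)$). $\alpha(G)$ is the size of a maximum independent set. $G$ is $\alpha$-stable if $\alpha(G-e)=\alpha(G)$ for every edge $e\in E(G)$, where $G-e$ is $G$ with the edge $e$ deleted; $\alpha$-$\textsc{Stability}$ is the set of $\alpha$-stable graphs. Running time is polynomial in the size of the encoding of $G$. *)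

theory Defs
  imports Main "HOL-Computational_Algebra.Polynomial"
begin

section \<open>Graphs\<close>

type_synonym 'a graph = "'a set \<times> 'a set set"

abbreviation verts :: "'a graph \<Rightarrow> 'a set" where
  "verts G \<equiv> fst G"

abbreviation edges :: "'a graph \<Rightarrow> 'a set set" where
  "edges G \<equiv> snd G"

definition simple_graph :: "'a graph \<Rightarrow> bool" where
  "simple_graph G \<longleftrightarrow> finite (verts G) \<and> (\<forall>e\<in>edges G. e \<subseteq> verts G \<and> card e = 2)"

definition graph_union :: "'a graph \<Rightarrow> 'a graph \<Rightarrow> 'a graph" where
  "graph_union G H = (verts G \<union> verts H, edges G \<union> edges H)"

definition graph_join :: "'a graph \<Rightarrow> 'a graph \<Rightarrow> 'a graph" where
  "graph_join G H =
     (verts G \<union> verts H, edges G \<union> edges H \<union> {{u, v} | u v. u \<in> verts G \<and> v \<in> verts H})"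

inductive cograph :: "'a graph \<Rightarrow> bool" where
  single: "cograph ({v}, {})"
| union: "cograph G \<Longrightarrow> cograph H \<Longrightarrow> verts G \<inter> verts H = {} \<Longrightarrow> cograph (graph_union G H)"
| join: "cograph G \<Longrightarrow> cograph H \<Longrightarrow> verts G \<inter> verts H = {} \<Longrightarrow> cograph (graph_join G H)"

lemma cograph_imp_simple_graph: "cograph G \<Longrightarrow> simple_graph G"
proof (induction rule: cograph.induct)
  case (single v)
  show ?case by (simp add: simple_graph_def)
next
  case (union G H)
  then show ?case by (auto simp: simple_graph_def graph_union_def)
next
  case (join G H)
  have "card {u, v} = 2" if "u \<in> verts G" "v \<in> verts H" for u v
    using that join.hyps by (metis card_2_iff disjoint_iff)
  with join.IH show ?case by (auto simp: simple_graph_def graph_join_def)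
qed

definition independent_set :: "'a graph \<Rightarrow> 'a set \<Rightarrow> bool" where
  "independent_set G S \<longleftrightarrow> S \<subseteq> verts G \<and> (\<forall>u\<in>S. \<forall>v\<in>S. {u, v} \<notin> edges G)"

definition alpha :: "'a graph \<Rightarrow> nat" where
  "alpha G = Max (card ` {S. independent_set G S})"

definition delete_edge :: "'a graph \<Rightarrow> 'a set \<Rightarrow> 'a graph" where
  "delete_edge G e = (verts G, edges G - {e})"

definition alpha_stability :: "'a graph set" where
  "alpha_stability =
     {G. simple_graph G \<and> (\<forall>e\<in>edges G. alpha (delete_edge G e) = alpha G)}"

section \<open>Deterministic multi-tape Turing machines\<close>

datatype direction = Left | Stay | Right

text \<open>
  The machine has states \<open>0, \<dots>, states - 1\<close> and tape alphabet \<open>0, \<dots>, symbols - 1\<close>, where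
  \<open>0\<close> is the blank. The transition function receives the current state and the list of scanned
  symbols (one per tape), and yields the next state and, for each tape, the symbol to write and
  the direction of the head. Only its values on this finite domain are ever used.
\<close>

record tm =
  tapes :: nat
  symbols :: nat
  states :: nat
  start :: nat
  accept :: nat
  reject :: nat
  delta :: "nat \<Rightarrow> nat list \<Rightarrow> nat \<times> (nat \<times> direction) list"

text \<open>At least four symbols: the blank and the three letters of the input alphabet below.\<close>

definition turing_machine :: "tm \<Rightarrow> bool" where
  "turing_machine M \<longleftrightarrow>
     tapes M \<ge> 1 \<and> symbols M \<ge> 4 \<and>
     start M < states M \<and> accept M < states M \<and> reject M < states M \<and> accept M \<noteq> reject M \<and>
     (\<forall>q ss q' as. q < states M \<and> length ss = tapes M \<and> (\<forall>s\<in>set ss. s < symbols M) \<and>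
        delta M q ss = (q', as) \<longrightarrow>
        q' < states M \<and> length as = tapes M \<and> (\<forall>(s, d)\<in>set as. s < symbols M))"

text \<open>A tape is infinite in both directions; it is paired with the position of its head.\<close>

type_synonym tape = "(int \<Rightarrow> nat) \<times> int"

type_synonym config = "nat \<times> tape list"

fun scan :: "tape \<Rightarrow> nat" where
  "scan (f, h) = f h"

fun shift :: "direction \<Rightarrow> int" where
  "shift Left = -1"
| "shift Stay = 0"
| "shift Right = 1"

fun act :: "nat \<times> direction \<Rightarrow> tape \<Rightarrow> tape" where
  "act (s, d) (f, h) = (f(h := s), h + shift d)"

fun step :: "tm \<Rightarrow> config \<Rightarrow> config" where
  "step M (q, ts) =
     (if q = accept M \<or> q = reject M then (q, ts)
      else let (q', as) = delta M q (map scan ts) in (q', map2 act as ts))"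

datatype letter = Zero | One | Sep

fun symbol_of :: "letter \<Rightarrow> nat" where
  "symbol_of Zero = 1"
| "symbol_of One = 2"
| "symbol_of Sep = 3"

definition input_tape :: "letter list \<Rightarrow> tape" where
  "input_tape w =
     ((\<lambda>i. if 0 \<le> i \<and> i < int (length w) then symbol_of (w ! nat i) else 0), 0)"

definition blank_tape :: tape where
  "blank_tape = ((\<lambda>i. 0), 0)"

definition initial_config :: "tm \<Rightarrow> letter list \<Rightarrow> config" where
  "initial_config M w = (start M, input_tape w # replicate (tapes M - 1) blank_tape)"

definition run :: "tm \<Rightarrow> letter list \<Rightarrow> nat \<Rightarrow> config" where
  "run M w t = (step M ^^ t) (initial_config M w)"

text \<open>
  Halting configurations are fixed by \<^const>\<open>step\<close>, so being in state \<open>accept\<close> (or \<open>reject\<close>) after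
  \<open>T\<close> steps means halting in that state within \<open>T\<close> steps.
\<close>

definition accepts_within :: "tm \<Rightarrow> letter list \<Rightarrow> nat \<Rightarrow> bool" where
  "accepts_within M w T \<longleftrightarrow> fst (run M w T) = accept M"

definition rejects_within :: "tm \<Rightarrow> letter list \<Rightarrow> nat \<Rightarrow> bool" where
  "rejects_within M w T \<longleftrightarrow> fst (run M w T) = reject M"

text \<open>
  The problem \<open>L\<close> restricted to instances from the class \<open>C\<close> is in P: one machine decides, for
  every instance \<open>x\<close> from \<open>C\<close> and every word \<open>w\<close> that encodes \<open>x\<close>, whether \<open>x \<in> L\<close>, in time
  polynomial in the length of \<open>w\<close>. Nothing is required on words that encode no instance from \<open>C\<close>.
\<close>

definition in_P_for :: "('a \<Rightarrow> letter list \<Rightarrow> bool) \<Rightarrow> 'a set \<Rightarrow> 'a set \<Rightarrow> bool" where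
  "in_P_for encodes C L \<longleftrightarrow>
     (\<exists>M (p :: nat poly). turing_machine M \<and>
        (\<forall>x\<in>C. \<forall>w. encodes x w \<longrightarrow>
           (if x \<in> L then accepts_within M w (poly p (length w))
            else rejects_within M w (poly p (length w)))))"

section \<open>Encoding of graphs\<close>

text \<open>
  The adjacency matrix with respect to an enumeration of the vertices, row by row, each row
  terminated by a separator. A graph with \<open>n\<close> vertices has encodings of length \<open>n * (n + 1)\<close>,
  one for each enumeration.
\<close>

definition adjacency_matrix :: "'a graph \<Rightarrow> 'a list \<Rightarrow> letter list" where
  "adjacency_matrix G xs =
     concat (map (\<lambda>u. map (\<lambda>v. if {u, v} \<in> edges G then One else Zero) xs @ [Sep]) xs)"

definition graph_encoding :: "'a graph \<Rightarrow> letter list \<Rightarrow> bool" where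
  "graph_encoding G w \<longleftrightarrow>
     (\<exists>xs. distinct xs \<and> set xs = verts G \<and> w = adjacency_matrix G xs)"

end

theory Submission
  imports Defs
begin

text \<open>
  Every cograph with an edge has an edge \<open>xy\<close> such that all vertices of \<open>X = N(y) - N(x)\<close> are false
  twins of \<open>x\<close> and all vertices of \<open>Y = N(x) - N(y)\<close> are false twins of \<open>y\<close>. A maximum
  independent set meeting \<open>X\<close> contains \<open>X\<close>, and \<open>Y\<close> can replace \<open>X\<close> in it; so the smaller class,
  say \<open>X\<close>, can be deleted without changing the independence number. To keep track of stability,
  vertices carry marks, and a marked graph counts as stable if it is stable and no maximum
  independent set contains a marked vertex. Deleting \<open>X\<close> preserves this if \<open>y\<close> becomes marked
  whenever \<open>X\<close> and \<open>Y\<close> have the same size and either are singletons or \<open>X\<close> contains a mark. After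
  at most \<open>n\<close> deletions no edge is left, and the graph was stable iff no mark survives.

  Each deletion is described by a first-order formula with counting over the current graph.
  Evaluating such a formula by nested loops over the vertices takes polynomial time on a multi-tape
  machine that holds one vertex variable, in unary, per tape. The control states of the machine are
  the stacks of program fragments that remain to be executed; there are finitely many of them.
\<close>

section \<open>Structured tape programs\<close>

text \<open>The input is an adjacency matrix, not a cotree, so the recursive structure is replaced
  by a local reduction; it never gets stuck because the pair exists in every induced subgraph of a
  cograph that has an edge. Edge deletion is avoided as well: removing \<open>uv\<close> raises the
  independence number iff some \<open>S\<close> avoiding \<open>u\<close> and \<open>v\<close> makes
  both \<open>S + u\<close> and \<open>S + v\<close> maximum independent sets. Why one mark per
  vertex suffices: if \<open>X\<close> is strictly smaller than \<open>Y\<close>, the exchange would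
  enlarge a maximum set, so no maximum set meets \<open>X\<close> and nothing is lost. If the sizes
  agree, a maximum set meets \<open>Y\<close> only if trading \<open>Y\<close> for \<open>X\<close>
  gives another one. For singletons these two sets make the edge \<open>xy\<close> critical; if
  \<open>X\<close> has a mark, the second set hits it. In both cases stability fails as soon as
  \<open>y\<close> lies in a maximum set, which is what a mark on \<open>y\<close> says. For equal
  classes of size at least two no critical edge ends in \<open>X\<close>: if \<open>u\<close> is in
  \<open>X\<close> and \<open>S + u\<close> is maximum, then \<open>S\<close> already meets
  \<open>X\<close>, so a maximum \<open>S + v\<close> would have to contain
  \<open>u\<close>.\<close>

datatype com =
    Put nat nat
  | Go nat direction
  | Seq com com (infixr ";;" 60)
  | Cond nat nat com com
  | Until nat nat com

fun put :: "nat \<Rightarrow> tape \<Rightarrow> tape" where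
  "put s (f, h) = (f(h := s), h)"

fun go :: "direction \<Rightarrow> tape \<Rightarrow> tape" where
  "go d (f, h) = (f, h + shift d)"

type_synonym mem = "nat \<Rightarrow> tape"

fun cstep :: "com list \<times> mem \<Rightarrow> com list \<times> mem" where
  "cstep ([], \<tau>) = ([], \<tau>)"
| "cstep (Put i s # K, \<tau>) = (K, \<tau>(i := put s (\<tau> i)))"
| "cstep (Go i d # K, \<tau>) = (K, \<tau>(i := go d (\<tau> i)))"
| "cstep ((a ;; b) # K, \<tau>) = (a # b # K, \<tau>)"
| "cstep (Cond i s a b # K, \<tau>) = ((if scan (\<tau> i) = s then a else b) # K, \<tau>)"
| "cstep (Until i s a # K, \<tau>) = (if scan (\<tau> i) = s then K else a # Until i s a # K, \<tau>)"

text \<open>Step count and final memory are fixed before the continuation \<open>K\<close> is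
  chosen, so a fragment behaves alike whatever remains on the stack. \<open>T\<close> is only an
  upper bound; unfolding a composite fragment costs one step, hence the summands 1 in the rules
  below.\<close>

definition wp :: "com \<Rightarrow> nat \<Rightarrow> (mem \<Rightarrow> bool) \<Rightarrow> mem \<Rightarrow> bool" where
  "wp c T Q \<tau> \<longleftrightarrow>
     (\<exists>t\<le>T. \<exists>\<tau>'. (\<forall>K. (cstep ^^ t) (c # K, \<tau>) = (K, \<tau>')) \<and> Q \<tau>')"

lemma funpow_Suc_apply: "(f ^^ Suc n) x = (f ^^ n) (f x)"
  by (simp add: funpow_Suc_right del: funpow.simps)

lemma wp_mono:
  assumes "wp c T Q \<tau>" "T \<le> T'" "\<And>\<tau>'. Q \<tau>' \<Longrightarrow> Q' \<tau>'"
  shows "wp c T' Q' \<tau>"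
  using assms unfolding wp_def by (meson le_trans)

lemma wp_Put: "Q (\<tau>(i := put s (\<tau> i))) \<Longrightarrow> wp (Put i s) 1 Q \<tau>"
  unfolding wp_def by (intro exI[of _ 1]) auto

lemma wp_Go: "Q (\<tau>(i := go d (\<tau> i))) \<Longrightarrow> wp (Go i d) 1 Q \<tau>"
  unfolding wp_def by (intro exI[of _ 1]) auto

lemma wp_Seq:
  assumes "wp a T1 (wp b T2 Q) \<tau>"
  shows "wp (a ;; b) (T1 + T2 + 1) Q \<tau>"
proof -
  obtain t1 \<tau>1 where 1: "t1 \<le> T1" "\<And>K. (cstep ^^ t1) (a # K, \<tau>) = (K, \<tau>1)" "wp b T2 Q \<tau>1"
    using assms unfolding wp_def by auto
  obtain t2 \<tau>2 where 2: "t2 \<le> T2" "\<And>K. (cstep ^^ t2) (b # K, \<tau>1) = (K, \<tau>2)" "Q \<tau>2"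
    using 1(3) unfolding wp_def by auto
  have "(cstep ^^ (t2 + Suc t1)) ((a ;; b) # K, \<tau>) = (K, \<tau>2)" for K
    unfolding funpow_add o_apply funpow_Suc_apply cstep.simps 1(2) 2(2) ..
  then show ?thesis
    unfolding wp_def using 1(1) 2(1,3) by (intro exI[of _ "t2 + Suc t1"]) auto
qed

lemma wp_Cond:
  assumes "scan (\<tau> i) = s \<Longrightarrow> wp a T Q \<tau>" "scan (\<tau> i) \<noteq> s \<Longrightarrow> wp b T Q \<tau>"
  shows "wp (Cond i s a b) (T + 1) Q \<tau>"
proof -
  have "wp (if scan (\<tau> i) = s then a else b) T Q \<tau>"
    using assms by simp
  then obtain t \<tau>' where "t \<le> T" "Q \<tau>'"
      "\<And>K. (cstep ^^ t) ((if scan (\<tau> i) = s then a else b) # K, \<tau>) = (K, \<tau>')"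
    unfolding wp_def by auto
  then show ?thesis
    unfolding wp_def by (intro exI[of _ "Suc t"]) (auto simp: funpow_Suc_right simp del: funpow.simps)
qed

text \<open>The invariant is indexed by the number of completed rounds. Each of the \<open>m\<close>
  rounds pays one step for its test, and the final 1 pays for the test that exits.\<close>

lemma wp_Until:
  assumes "I 0 \<tau>"
    and body: "\<And>j \<tau>. j < m \<Longrightarrow> I j \<tau> \<Longrightarrow> scan (\<tau> i) \<noteq> s \<and> wp c T (I (Suc j)) \<tau>"
    and exit: "\<And>\<tau>. I m \<tau> \<Longrightarrow> scan (\<tau> i) = s \<and> Q \<tau>"
  shows "wp (Until i s c) (m * (T + 1) + 1) Q \<tau>"
proof -
  have "\<exists>t\<le>j * (T + 1). \<exists>\<tau>'. I j \<tau>' \<and>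
      (\<forall>K. (cstep ^^ t) (Until i s c # K, \<tau>) = (Until i s c # K, \<tau>'))" if "j \<le> m" for j
    using that
  proof (induction j)
    case 0
    then show ?case using assms(1) by auto
  next
    case (Suc j)
    then obtain t \<tau>1 where 1: "t \<le> j * (T + 1)" "I j \<tau>1"
        "\<And>K. (cstep ^^ t) (Until i s c # K, \<tau>) = (Until i s c # K, \<tau>1)"
      by auto
    obtain t2 \<tau>2 where 2: "t2 \<le> T" "I (Suc j) \<tau>2" "\<And>K. (cstep ^^ t2) (c # K, \<tau>1) = (K, \<tau>2)"
      using body[of j \<tau>1] 1(2) Suc.prems unfolding wp_def by auto
    have "(cstep ^^ (t2 + Suc t)) (Until i s c # K, \<tau>) = (Until i s c # K, \<tau>2)" for K
      using body[of j \<tau>1] 1(2) Suc.prems 2(3)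
      unfolding funpow_add o_apply funpow.simps(2) 1(3) funpow_swap1 by simp
    then show ?case
      using 1(1) 2(1,2) by (intro exI[of _ "t2 + Suc t"]) auto
  qed
  from this[of m] obtain t \<tau>' where "t \<le> m * (T + 1)" "I m \<tau>'"
      "\<And>K. (cstep ^^ t) (Until i s c # K, \<tau>) = (Until i s c # K, \<tau>')"
    by auto
  then show ?thesis
    unfolding wp_def using exit[of \<tau>'] by (intro exI[of _ "Suc t"]) auto
qed

subsection \<open>Compilation to Turing machines\<close>

fun valid :: "nat \<Rightarrow> com \<Rightarrow> bool" where
  "valid k (Put i s) = (i < k \<and> s < 4)"
| "valid k (Go i d) = (i < k)"
| "valid k (a ;; b) = (valid k a \<and> valid k b)"
| "valid k (Cond i s a b) = (i < k \<and> valid k a \<and> valid k b)"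
| "valid k (Until i s a) = (i < k \<and> valid k a)"

text \<open>Contains every stack that can occur before control reaches \<open>K\<close>. A loop is
  the continuation of its own body, so the recursion descends into subterms only and the set stays
  finite.\<close>

fun stacks :: "com \<Rightarrow> com list \<Rightarrow> com list set" where
  "stacks (a ;; b) K = insert ((a ;; b) # K) (stacks a (b # K) \<union> stacks b K)"
| "stacks (Cond i s a b) K = insert (Cond i s a b # K) (stacks a K \<union> stacks b K)"
| "stacks (Until i s a) K = insert (Until i s a # K) (stacks a (Until i s a # K))"
| "stacks c K = {c # K}"

lemma finite_stacks: "finite (stacks c K)"
  by (induction c K rule: stacks.induct) auto

lemma stacks_start: "c # K \<in> stacks c K"
  by (cases c) auto

lemma stacks_valid: "L \<in> stacks c K \<Longrightarrow> valid k c \<Longrightarrow> \<forall>b\<in>set K. valid k b \<Longrightarrow> \<forall>b\<in>set L. valid k b"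
  by (induction c K rule: stacks.induct) auto

lemma stacks_cstep: "L \<in> stacks c K \<Longrightarrow> fst (cstep (L, \<tau>)) \<in> insert K (stacks c K)"
  by (induction c K rule: stacks.induct) (auto simp: stacks_start split: if_splits)

text \<open>The stack component of \<open>cstep\<close> as a function of the scanned symbols, which
  are all that a transition function may inspect.\<close>

fun next_stack :: "com list \<Rightarrow> nat list \<Rightarrow> com list" where
  "next_stack [] ss = []"
| "next_stack (Put i s # K) ss = K"
| "next_stack (Go i d # K) ss = K"
| "next_stack ((a ;; b) # K) ss = a # b # K"
| "next_stack (Cond i s a b # K) ss = (if ss ! i = s then a else b) # K"
| "next_stack (Until i s a # K) ss = (if ss ! i = s then K else a # Until i s a # K)"

fun actions :: "com list \<Rightarrow> nat list \<Rightarrow> (nat \<times> direction) list" where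
  "actions (Put i s # K) ss = (map (\<lambda>s. (s, Stay)) ss)[i := (s, Stay)]"
| "actions (Go i d # K) ss = (map (\<lambda>s. (s, Stay)) ss)[i := (ss ! i, d)]"
| "actions _ ss = map (\<lambda>s. (s, Stay)) ss"

lemma act_stay [simp]: "act (scan t, Stay) t = t"
  by (cases t) auto

lemma map2_act_stay [simp]: "map2 act (map (\<lambda>s. (s, Stay)) (map scan ts)) ts = ts"
  by (induction ts) auto

lemma map2_act_update:
  assumes "i < length ts"
  shows "map2 act ((map (\<lambda>s. (s, Stay)) (map scan ts))[i := p]) ts = ts[i := act p (ts ! i)]"
  using assms
proof (induction ts arbitrary: i)
  case (Cons t ts)
  then show ?case by (cases i) (simp_all del: map_map)
qed auto

lemma map_upt_update: "i < k \<Longrightarrow> (map \<tau> [0..<k])[i := t] = map (\<tau>(i := t)) [0..<k]"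
  by (rule nth_equalityI) (auto simp: nth_list_update)

lemma cstep_lists:
  assumes "\<forall>b\<in>set K. valid k b" "K \<noteq> []" "ts = map \<tau> [0..<k]"
  shows "next_stack K (map scan ts) = fst (cstep (K, \<tau>))"
    and "map2 act (actions K (map scan ts)) ts = map (snd (cstep (K, \<tau>))) [0..<k]"
proof -
  obtain c L where K: "K = c # L" using assms(2) by (cases K) auto
  have c: "valid k c" using assms(1) K by auto
  have put: "act (s, Stay) t = put s t" for s t by (cases t) auto
  have go: "act (scan t, d) t = go d t" for d t by (cases t) auto
  show "next_stack K (map scan ts) = fst (cstep (K, \<tau>))"
    using c unfolding K assms(3) by (cases c) auto
  show "map2 act (actions K (map scan ts)) ts = map (snd (cstep (K, \<tau>))) [0..<k]"
  proof (cases c)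
    case (Put i s)
    then have "i < length ts" using c assms(3) by auto
    with Put c show ?thesis
      unfolding K by (simp only: actions.simps map2_act_update) (simp add: assms(3) put map_upt_update)
  next
    case (Go i d)
    then have "i < length ts" using c assms(3) by auto
    with Go c show ?thesis
      unfolding K by (simp only: actions.simps map2_act_update) (simp add: assms(3) go map_upt_update)
  next
    case (Seq a b)
    then show ?thesis unfolding K by (simp del: map_map) (simp add: assms(3))
  next
    case (Cond i s a b)
    then show ?thesis unfolding K by (simp del: map_map) (simp add: assms(3))
  next
    case (Until i s a)
    then show ?thesis unfolding K by (simp del: map_map) (simp add: assms(3))
  qed
qed

text \<open>Any list of symbols is scanned by a memory of constant tapes. Closure of the state set
  under \<open>cstep\<close> thereby carries over to arbitrary arguments of the transition
  function.\<close>

lemma next_stack_fst_cstep: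
  "next_stack K ss = fst (cstep (K, \<lambda>i. (\<lambda>_. ss ! i, 0)))"
  by (cases K rule: list.exhaust; cases "hd K") auto

lemma actions_ok:
  assumes "\<forall>b\<in>set K. valid (length ss) b" "\<forall>s\<in>set ss. s < 4"
  shows "length (actions K ss) = length ss \<and> (\<forall>(s, d)\<in>set (actions K ss). s < 4)"
proof (cases K)
  case (Cons c L)
  have c: "valid (length ss) c" using assms(1) Cons by auto
  show ?thesis
    using assms(2) c unfolding Cons
    by (cases c) (auto dest!: set_update_subset_insert[THEN subsetD])
qed (use assms(2) in auto)

definition initial_mem :: "letter list \<Rightarrow> mem" where
  "initial_mem w = (\<lambda>i. if i = 0 then input_tape w else blank_tape)"

text \<open>The strict bound \<open>T' > T\<close> leaves one step for the verdict: the empty stack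
  is a nonhalting state that inspects tape 2 and then enters \<open>accept\<close> or
  \<open>reject\<close>.\<close>

theorem compile_tm:
  assumes "valid k c" "2 < k"
  shows "\<exists>M. turing_machine M \<and>
    (\<forall>w T b. wp c T (\<lambda>\<tau>. scan (\<tau> 2) = 2 \<longleftrightarrow> b) (initial_mem w) \<longrightarrow>
       (\<forall>T'>T. if b then accepts_within M w T' else rejects_within M w T'))"
proof -
  define Q where "Q = insert [] (stacks c [])"
  have finQ: "finite Q" unfolding Q_def using finite_stacks by auto
  obtain e where e: "bij_betw e Q {0..<card Q}"
    using ex_bij_betw_finite_nat[OF finQ] by auto
  define dec where "dec = inv_into Q e"
  have dec_e: "dec (e K) = K" if "K \<in> Q" for K
    unfolding dec_def using e that by (metis bij_betw_inv_into_left)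
  have dec_Q: "dec q \<in> Q" if "q < card Q" for q
    unfolding dec_def using e that by (metis atLeastLessThan_iff bij_betw_imp_surj_on inv_into_into zero_le)
  have e_less: "e K < card Q" if "K \<in> Q" for K
    using e that by (metis atLeastLessThan_iff bij_betw_apply)
  have valQ: "\<forall>b\<in>set K. valid k b" if "K \<in> Q" for K
    using that stacks_valid[OF _ assms(1), of K "[]"] unfolding Q_def by auto
  have nextQ: "fst (cstep (K, \<tau>)) \<in> Q" if "K \<in> Q" for K \<tau>
    using that stacks_cstep[of K c "[]" \<tau>] unfolding Q_def by auto
  \<comment> \<open>States below \<open>card Q\<close> number the stacks via \<open>e\<close>; the
    two states above them are the halting ones.\<close>
  define M where "M = \<lparr>tapes = k, symbols = 4, states = card Q + 2, start = e [c],
    accept = card Q, reject = card Q + 1,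
    delta = (\<lambda>q ss. if q < card Q \<and> dec q \<noteq> [] then (e (next_stack (dec q) ss), actions (dec q) ss)
      else (if ss ! 2 = 2 then card Q else card Q + 1, map (\<lambda>s. (s, Stay)) ss))\<rparr>"
  have cQ: "[c] \<in> Q" unfolding Q_def by (simp add: stacks_start)
  have "turing_machine M"
  proof -
    have "q' < states M \<and> length as = tapes M \<and> (\<forall>(s, d)\<in>set as. s < symbols M)"
      if "length ss = tapes M" "\<forall>s\<in>set ss. s < symbols M" "delta M q ss = (q', as)" for q ss q' as
    proof (cases "q < card Q \<and> dec q \<noteq> []")
      case True
      then have "q' = e (next_stack (dec q) ss)" "as = actions (dec q) ss"
        using that(3) by (auto simp: M_def)
      moreover have "e (next_stack (dec q) ss) < card Q"
        unfolding next_stack_fst_cstep by (intro e_less nextQ dec_Q) (use True in simp)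
      moreover have "length (actions (dec q) ss) = length ss \<and> (\<forall>(s, d)\<in>set (actions (dec q) ss). s < 4)"
        by (rule actions_ok) (use True that valQ[OF dec_Q] in \<open>auto simp: M_def\<close>)
      ultimately show ?thesis using that(1) by (auto simp: M_def)
    next
      case False
      then show ?thesis using that by (auto simp: M_def split: if_splits)
    qed
    moreover have "tapes M \<ge> 1 \<and> symbols M \<ge> 4 \<and> start M < states M \<and> accept M < states M \<and>
        reject M < states M \<and> accept M \<noteq> reject M"
      using assms(2) e_less[OF cQ] by (simp add: M_def)
    ultimately show ?thesis
      unfolding turing_machine_def by blast
  qed
  moreover have "if b then accepts_within M w T' else rejects_within M w T'"
    if wp: "wp c T (\<lambda>\<tau>. scan (\<tau> 2) = 2 \<longleftrightarrow> b) (initial_mem w)" and T': "T < T'" for w T b T'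
  proof -
    obtain t \<tau>' where t: "t \<le> T" "(cstep ^^ t) ([c], initial_mem w) = ([], \<tau>')" "scan (\<tau>' 2) = 2 \<longleftrightarrow> b"
      using wp unfolding wp_def by blast
    have init: "initial_config M w = (e [c], map (initial_mem w) [0..<k])"
    proof -
      obtain k' where "k = Suc k'" using assms(2) by (cases k) auto
      then show ?thesis
        by (simp add: initial_config_def M_def initial_mem_def upt_conv_Cons del: upt_Suc)
          (rule nth_equalityI; simp del: upt_Suc)
    qed
    have sim: "step M (e K, map \<tau> [0..<k]) = (e (fst (cstep (K, \<tau>))), map (snd (cstep (K, \<tau>))) [0..<k])"
      if "K \<in> Q" "K \<noteq> []" for K \<tau>
      using cstep_lists[OF valQ[OF that(1)] that(2) refl, of \<tau>] e_less[OF that(1)] that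
      by (simp add: M_def dec_e)
    have halt: "step M (e [], map \<tau> [0..<k]) = (if scan (\<tau> 2) = 2 then card Q else card Q + 1, map \<tau> [0..<k])"
      for \<tau>
    proof -
      have "[] \<in> Q" unfolding Q_def by simp
      then show ?thesis
        using e_less[of "[]"] assms(2) map2_act_stay[of "map \<tau> [0..<k]"]
        by (simp add: M_def dec_e flip: numeral_2_eq_2)
    qed
    have halting: "accept M = card Q" "reject M = card Q + 1"
      by (simp_all add: M_def)
    have fixed: "(step M ^^ s) (q, ts) = (q, ts)" if "q = accept M \<or> q = reject M" for s q ts
      using that by (induction s) auto
    \<comment> \<open>\<open>cstep\<close> idles on the empty stack whereas the machine moves on to
      the verdict, so the machine is followed only until the stack becomes empty, possibly before
      \<open>s\<close> steps.\<close>
    have cs: "(cstep ^^ s) (K, \<tau>) = ([], \<tau>') \<Longrightarrow> K \<in> Q \<Longrightarrow>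
      \<exists>s'\<le>s. (step M ^^ s') (e K, map \<tau> [0..<k]) = (e [], map \<tau>' [0..<k])" for s K \<tau>
    proof (induction s arbitrary: K \<tau>)
      case 0
      then show ?case by auto
    next
      case (Suc s)
      show ?case
      proof (cases "K = []")
        case True
        moreover have "(cstep ^^ s) ([], \<tau>) = ([], \<tau>)" for s \<tau> by (induction s) auto
        ultimately show ?thesis using Suc.prems(1) by (intro exI[of _ 0]) (auto simp del: funpow.simps)
      next
        case False
        obtain K1 \<tau>1 where K1: "cstep (K, \<tau>) = (K1, \<tau>1)" by fastforce
        have "(cstep ^^ s) (K1, \<tau>1) = ([], \<tau>')"
          using Suc.prems(1) K1 by (simp add: funpow_Suc_right del: funpow.simps)
        moreover have "K1 \<in> Q" using nextQ[OF Suc.prems(2), of \<tau>] K1 by simp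
        ultimately obtain s' where "s' \<le> s" "(step M ^^ s') (e K1, map \<tau>1 [0..<k]) = (e [], map \<tau>' [0..<k])"
          using Suc.IH by blast
        then show ?thesis
          using sim[OF Suc.prems(2) False, of \<tau>] K1
          by (intro exI[of _ "Suc s'"]) (simp add: funpow_Suc_right del: funpow.simps step.simps)
      qed
    qed
    obtain s where s: "s \<le> t" "(step M ^^ s) (e [c], map (initial_mem w) [0..<k]) = (e [], map \<tau>' [0..<k])"
      using cs[OF t(2) cQ] by blast
    \<comment> \<open>\<open>s\<close> simulated steps, one step for the verdict, and
      \<open>r\<close> steps idling in a halting state.\<close>
    obtain r where r: "T' = r + Suc s" using s(1) t(1) T' by (metis add.commute le_less_trans less_iff_Suc_add add_Suc_right add_Suc)
    have "fst (run M w T') = (if b then card Q else card Q + 1)"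
      unfolding run_def r init funpow_add using s(2) halt[of \<tau>'] t(3)
      by (simp add: fixed halting del: step.simps)
    then show ?thesis
      by (auto simp: accepts_within_def rejects_within_def halting)
  qed
  ultimately show ?thesis by blast
qed

lemmas wp_simps = wp_Go wp_Put wp_Go[unfolded One_nat_def] wp_Put[unfolded One_nat_def]

section \<open>A query language on marked graphs\<close>

text \<open>
  \<open>Le c x j \<phi> \<psi>\<close> compares the numbers of values of \<open>x\<close> satisfying \<open>\<phi>\<close> and \<open>\<psi>\<close>, the latter
  increased by \<open>j\<close>; tape \<open>c\<close> serves as the counter.
\<close>

datatype fm =
    Adj nat nat
  | Mark nat nat
  | Neg fm
  | Conj fm fm
  | Ex nat fm
  | Le nat nat nat fm fm

datatype cmd =
    Set nat nat
  | Sq cmd cmd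
  | When fm cmd
  | For nat cmd

fun sat :: "nat \<Rightarrow> (nat \<Rightarrow> nat \<Rightarrow> bool) \<Rightarrow> (nat \<Rightarrow> nat) \<Rightarrow> (nat \<Rightarrow> nat) \<Rightarrow> fm \<Rightarrow> bool" where
  "sat n E m \<sigma> (Adj x y) = E (\<sigma> x) (\<sigma> y)"
| "sat n E m \<sigma> (Mark x s) = (m (\<sigma> x) = s)"
| "sat n E m \<sigma> (Neg \<phi>) = (\<not> sat n E m \<sigma> \<phi>)"
| "sat n E m \<sigma> (Conj \<phi> \<psi>) = (sat n E m \<sigma> \<phi> \<and> sat n E m \<sigma> \<psi>)"
| "sat n E m \<sigma> (Ex x \<phi>) = (\<exists>i<n. sat n E m (\<sigma>(x := i)) \<phi>)"
| "sat n E m \<sigma> (Le c x j \<phi> \<psi>) =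
     (card {i. i < n \<and> sat n E m (\<sigma>(x := i)) \<phi>} \<le> card {i. i < n \<and> sat n E m (\<sigma>(x := i)) \<psi>} + j)"

fun exec :: "nat \<Rightarrow> (nat \<Rightarrow> nat \<Rightarrow> bool) \<Rightarrow> cmd \<Rightarrow> (nat \<Rightarrow> nat) \<Rightarrow> (nat \<Rightarrow> nat) \<Rightarrow> nat \<Rightarrow> nat" where
  "exec n E (Set x s) \<sigma> m = m(\<sigma> x := s)"
| "exec n E (Sq c d) \<sigma> m = exec n E d \<sigma> (exec n E c \<sigma> m)"
| "exec n E (When \<phi> c) \<sigma> m = (if sat n E m \<sigma> \<phi> then exec n E c \<sigma> m else m)"
| "exec n E (For x c) \<sigma> m = fold (\<lambda>i. exec n E c (\<sigma>(x := i))) [0..<n] m"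

fun fv :: "fm \<Rightarrow> nat set" where
  "fv (Adj x y) = {x, y}"
| "fv (Mark x s) = {x}"
| "fv (Neg \<phi>) = fv \<phi>"
| "fv (Conj \<phi> \<psi>) = fv \<phi> \<union> fv \<psi>"
| "fv (Ex x \<phi>) = fv \<phi> - {x}"
| "fv (Le c x j \<phi> \<psi>) = (fv \<phi> \<union> fv \<psi>) - {x}"

fun fvc :: "cmd \<Rightarrow> nat set" where
  "fvc (Set x s) = {x}"
| "fvc (Sq c d) = fvc c \<union> fvc d"
| "fvc (When \<phi> c) = fv \<phi> \<union> fvc c"
| "fvc (For x c) = fvc c - {x}"

text \<open>Tapes below 4 are reserved. \<open>V\<close> collects the variables whose head positions
  must survive: a quantifier moves the head of its variable, and a comparison also that of its
  counter, so both have to be fresh, and the counter must not be read by the subformulas.\<close>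

fun wff :: "nat \<Rightarrow> nat set \<Rightarrow> fm \<Rightarrow> bool" where
  "wff k V (Adj x y) = (x \<in> {4..<k} \<and> y \<in> {4..<k})"
| "wff k V (Mark x s) = (x \<in> {4..<k})"
| "wff k V (Neg \<phi>) = wff k V \<phi>"
| "wff k V (Conj \<phi> \<psi>) = (wff k V \<phi> \<and> wff k V \<psi>)"
| "wff k V (Ex x \<phi>) = (x \<in> {4..<k} - V \<and> wff k (insert x V) \<phi>)"
| "wff k V (Le c x j \<phi> \<psi>) = (c \<in> {4..<k} - V \<and> x \<in> {4..<k} - V \<and> c \<noteq> x \<and> c \<notin> fv \<phi> \<union> fv \<psi> \<and>
     wff k (insert x (insert c V)) \<phi> \<and> wff k (insert x (insert c V)) \<psi>)"

text \<open>A written mark is never 0, since a blank would be mistaken for the end of the tape of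
  marks, and it is below 4, the size of the alphabet.\<close>

fun wfc :: "nat \<Rightarrow> nat set \<Rightarrow> cmd \<Rightarrow> bool" where
  "wfc k V (Set x s) = (x \<in> {4..<k} \<and> s \<in> {1..<4})"
| "wfc k V (Sq c d) = (wfc k V c \<and> wfc k V d)"
| "wfc k V (When \<phi> c) = (wff k V \<phi> \<and> wfc k V c)"
| "wfc k V (For x c) = (x \<in> {4..<k} - V \<and> wfc k (insert x V) c)"

subsection \<open>Compilation to tape programs\<close>

definition tp :: "nat \<Rightarrow> (nat \<Rightarrow> nat) \<Rightarrow> int \<Rightarrow> tape" where
  "tp n m h = (\<lambda>i. if 0 \<le> i \<and> i < int n then m (nat i) else 0, h)"

lemma scan_tp [simp]: "scan (tp n m h) = (if 0 \<le> h \<and> h < int n then m (nat h) else 0)"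
  by (simp add: tp_def)

lemma go_tp [simp]: "go d (tp n m h) = tp n m (h + shift d)"
  by (simp add: tp_def)

lemma put_tp: "h < n \<Longrightarrow> put s (tp n m (int h)) = tp n (m(h := s)) (int h)"
  by (auto simp: tp_def fun_eq_iff)

lemma scan_put [simp]: "scan (put s t) = s"
  by (cases t) simp

abbreviation unary :: "nat \<Rightarrow> int \<Rightarrow> tape" where
  "unary n \<equiv> tp n (\<lambda>_. 1)"

text \<open>The first move to the left is for a head at position \<open>n\<close>, which already
  scans a blank and would end the loop at once.\<close>

definition rewind :: "nat \<Rightarrow> com" where
  "rewind i = Go i Left ;; Until i 0 (Go i Left) ;; Go i Right"

lemma wp_rewind:
  assumes "\<tau> i = tp n m (int h)" "h \<le> n" "\<And>j. j < n \<Longrightarrow> m j \<noteq> 0" "Q (\<tau>(i := tp n m 0))"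
  shows "wp (rewind i) (2 * n + 6) Q \<tau>"
proof -
  have "wp (rewind i) (1 + ((h * (1 + 1) + 1) + 1 + 1) + 1) Q \<tau>"
    unfolding rewind_def
    by (rule wp_Seq, rule wp_Go, rule wp_Seq,
        rule wp_Until[where I = "\<lambda>j \<tau>'. \<tau>' = \<tau>(i := tp n m (int h - 1 - int j))"])
      (use assms in \<open>auto intro!: wp_simps simp: nat_less_iff\<close>)
  then show ?thesis
    by (rule wp_mono) (use assms(2) in auto)
qed

text \<open>Runs \<open>B\<close> as many times as the head position of \<open>x\<close> says. That
  position is lost on the way, so \<open>B\<close> has to copy it to another tape, from which
  \<open>ascend\<close> restores it.\<close>

definition descend :: "nat \<Rightarrow> com \<Rightarrow> com" where
  "descend x B = Go x Left ;; Until x 0 (B ;; Go x Left)"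

text \<open>\<open>g j\<close> is the memory after \<open>j\<close> runs of \<open>B\<close> up to
  tape \<open>x\<close>; the body is specified for arbitrary contents \<open>p\<close> of that
  tape.\<close>

lemma wp_descend:
  assumes "\<tau> = (g 0)(x := unary n (int h))" "h \<le> n"
    and body: "\<And>j p. j < h \<Longrightarrow> wp B T (\<lambda>\<tau>'. \<tau>' = (g (Suc j))(x := p)) ((g j)(x := p))"
    and Q: "Q ((g h)(x := unary n (-1)))"
  shows "wp (descend x B) (h * (T + 3) + 3) Q \<tau>"
proof -
  have "wp (descend x B) (1 + (h * ((T + 1 + 1) + 1) + 1) + 1) Q \<tau>"
    unfolding descend_def
  proof (rule wp_Seq, rule wp_Go,
      rule wp_Until[where I = "\<lambda>j \<tau>'. \<tau>' = (g j)(x := unary n (int h - 1 - int j))"])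
    fix j \<tau>' assume j: "j < h" and \<tau>': "\<tau>' = (g j)(x := unary n (int h - 1 - int j))"
    have "wp (B ;; Go x Left) (T + 1 + 1) (\<lambda>\<tau>'. \<tau>' = (g (Suc j))(x := unary n (int h - 1 - int (Suc j)))) \<tau>'"
      unfolding \<tau>' by (rule wp_Seq, rule wp_mono[OF body[OF j] order_refl]) (auto intro!: wp_simps simp: algebra_simps)
    then show "scan (\<tau>' x) \<noteq> 0 \<and> wp (B ;; Go x Left) (T + 1 + 1)
        (\<lambda>\<tau>'. \<tau>' = (g (Suc j))(x := unary n (int h - 1 - int (Suc j)))) \<tau>'"
      using j assms(2) \<tau>' by auto
  qed (use assms in auto)
  then show ?thesis
    by (rule wp_mono) (auto simp: algebra_simps)
qed

text \<open>Transfers the head position of \<open>t\<close> to \<open>x\<close>, whose head stands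
  just left of the tape, and rewinds \<open>t\<close> in the same loop.\<close>

definition ascend :: "nat \<Rightarrow> nat \<Rightarrow> com" where
  "ascend x t = Go x Right ;; Go t Left ;; Until t 0 (Go x Right ;; Go t Left) ;; Go t Right"

lemma wp_ascend:
  assumes "\<tau> x = unary n (-1)" "\<tau> t = tp l m (int h)" "h \<le> l" "\<And>j. j < h \<Longrightarrow> m j \<noteq> 0" "x \<noteq> t"
    and "Q (\<tau>(x := unary n (int h), t := tp l m 0))"
  shows "wp (ascend x t) (4 * h + 7) Q \<tau>"
proof -
  have "wp (ascend x t) (1 + (1 + ((h * ((1 + 1 + 1) + 1) + 1) + 1 + 1) + 1) + 1) Q \<tau>"
    unfolding ascend_def
  proof (rule wp_Seq, rule wp_Go, rule wp_Seq, rule wp_Go, rule wp_Seq,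
      rule wp_Until[where I = "\<lambda>j \<tau>'. \<tau>' = \<tau>(x := unary n (int j), t := tp l m (int h - 1 - int j))"])
    fix j \<tau>' assume j: "j < h"
      and \<tau>': "\<tau>' = \<tau>(x := unary n (int j), t := tp l m (int h - 1 - int j))"
    have "wp (Go x Right ;; Go t Left) (1 + 1 + 1)
        (\<lambda>\<tau>'. \<tau>' = \<tau>(x := unary n (int (Suc j)), t := tp l m (int h - 1 - int (Suc j)))) \<tau>'"
      unfolding \<tau>'
      by (rule wp_Seq, rule wp_Go, rule wp_Go) (use assms in \<open>auto simp: algebra_simps fun_eq_iff\<close>)
    then show "scan (\<tau>' t) \<noteq> 0 \<and> wp (Go x Right ;; Go t Left) (1 + 1 + 1)
        (\<lambda>\<tau>'. \<tau>' = \<tau>(x := unary n (int (Suc j)), t := tp l m (int h - 1 - int (Suc j)))) \<tau>'"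
      using j assms \<tau>' by auto
  next
    fix \<tau>' assume "\<tau>' = \<tau>(x := unary n (int h), t := tp l m (int h - 1 - int h))"
    then show "scan (\<tau>' t) = 0 \<and> wp (Go t Right) 1 Q \<tau>'"
      using assms by (auto intro!: wp_simps)
  qed (use assms in \<open>auto simp: fun_eq_iff\<close>)
  then show ?thesis
    by (rule wp_mono) auto
qed

abbreviation answer :: "nat \<Rightarrow> nat \<Rightarrow> com" where
  "answer i s \<equiv> Cond i s (Put 2 2) (Put 2 1)"

abbreviation skip :: com where
  "skip \<equiv> Go 2 Stay"

lemma wp_skip: "Q \<tau> \<Longrightarrow> wp skip 1 Q \<tau>"
proof -
  have "go Stay (\<tau> 2) = \<tau> 2" by (cases "\<tau> 2") simp
  then show "Q \<tau> \<Longrightarrow> wp skip 1 Q \<tau>" by (intro wp_Go) simp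
qed

text \<open>Truncated subtraction on a head position: a head that falls off the left end steps back
  to 0.\<close>

definition dec :: "nat \<Rightarrow> com" where
  "dec c = Go c Left ;; Cond c 0 (Go c Right) skip"

lemma wp_dec:
  assumes "\<tau> c = unary n (int h)" "h \<le> n" "Q (\<tau>(c := unary n (int (h - 1))))"
  shows "wp (dec c) 4 Q \<tau>"
proof -
  have "wp (dec c) (1 + (1 + 1) + 1) Q \<tau>"
    unfolding dec_def
    by (rule wp_Seq, rule wp_Go, rule wp_Cond)
      (use assms in \<open>cases h; auto intro!: wp_simps wp_skip wp_skip[unfolded One_nat_def]\<close>)+
  then show ?thesis by (rule wp_mono) auto
qed

fun repeat :: "nat \<Rightarrow> com \<Rightarrow> com" where
  "repeat 0 c = skip"
| "repeat (Suc j) c = c ;; repeat j c"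

lemma wp_repeat_dec:
  assumes "\<tau> c = unary n (int h)" "h \<le> n" "Q (\<tau>(c := unary n (int (h - j))))"
  shows "wp (repeat j (dec c)) (5 * j + 1) Q \<tau>"
  using assms
proof (induction j arbitrary: h \<tau>)
  case 0
  then have "\<tau>(c := unary n (int h)) = \<tau>" by auto
  with 0 show ?case by (auto intro!: wp_skip wp_skip[unfolded One_nat_def] simp flip: fun_upd_def)
next
  case (Suc j)
  have "wp (dec c ;; repeat j (dec c)) (4 + (5 * j + 1) + 1) Q \<tau>"
    by (rule wp_Seq, rule wp_dec[where h = h and n = n and c = c and \<tau> = \<tau>, OF Suc.prems(1,2)], rule Suc.IH[where h = "h - 1"])
      (use Suc.prems in \<open>auto simp flip: fun_upd_def\<close>)
  then show ?case by (simp add: algebra_simps)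
qed

definition skip_row :: com where
  "skip_row = Until 0 3 (Go 0 Right) ;; Go 0 Right"

text \<open>Tape 3 counts the rows and then the columns passed, so that the positions of
  \<open>x\<close> and \<open>y\<close> can be restored.\<close>

definition find_entry :: "nat \<Rightarrow> nat \<Rightarrow> com" where
  "find_entry x y =
     descend x (skip_row ;; Go 3 Right) ;; ascend x 3 ;;
     descend y (Go 0 Right ;; Go 3 Right) ;; ascend y 3"

text \<open>In \<open>Conj\<close> a false first answer simply stays on tape 2; in \<open>Ex\<close>
  a true answer makes the later rounds skip. For \<open>Le\<close> the counter goes up for
  \<open>\<phi>\<close> and then down, truncated at 0, for \<open>\<psi>\<close> and
  \<open>j\<close> more times; it ends at 0 iff the comparison holds.\<close>

fun code :: "fm \<Rightarrow> com" where
  "code (Adj x y) = find_entry x y ;; answer 0 2 ;; rewind 0"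
| "code (Mark x s) = descend x (Go 1 Right) ;; answer 1 s ;; ascend x 1"
| "code (Neg \<phi>) = code \<phi> ;; Cond 2 2 (Put 2 1) (Put 2 2)"
| "code (Conj \<phi> \<psi>) = code \<phi> ;; Cond 2 2 (code \<psi>) skip"
| "code (Ex x \<phi>) = rewind x ;; Put 2 1 ;; Until x 0 (Cond 2 2 skip (code \<phi>) ;; Go x Right)"
| "code (Le c x j \<phi> \<psi>) =
     rewind c ;; rewind x ;; Until x 0 ((code \<phi> ;; Cond 2 2 (Go c Right) skip) ;; Go x Right) ;;
     rewind x ;; Until x 0 ((code \<psi> ;; Cond 2 2 (dec c) skip) ;; Go x Right) ;;
     repeat j (dec c) ;; Go c Left ;; answer c 0 ;; Go c Right"

fun code_cmd :: "cmd \<Rightarrow> com" where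
  "code_cmd (Set x s) = descend x (Go 1 Right) ;; Put 1 s ;; ascend x 1"
| "code_cmd (Sq c d) = code_cmd c ;; code_cmd d"
| "code_cmd (When \<phi> c) = code \<phi> ;; Cond 2 2 (code_cmd c) skip"
| "code_cmd (For x c) = rewind x ;; Until x 0 (code_cmd c ;; Go x Right)"

text \<open>Polynomials in the number of vertices, read off from the \<open>wp\<close> rules and
  rounded up. The factor \<open>[:0, 1:]\<close> is the loop over the vertices; the square in
  \<open>Adj\<close> comes from walking over the matrix.\<close>

fun cost :: "fm \<Rightarrow> nat poly" where
  "cost (Adj x y) = [:35, 24, 4:]"
| "cost (Mark x s) = [:15, 8:]"
| "cost (Neg \<phi>) = cost \<phi> + [:3:]"
| "cost (Conj \<phi> \<psi>) = cost \<phi> + cost \<psi> + [:3:]"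
| "cost (Ex x \<phi>) = [:0, 1:] * (cost \<phi> + [:7:]) + [:10:]"
| "cost (Le c x j \<phi> \<psi>) = [:0, 1:] * (cost \<phi> + cost \<psi> + [:25:]) + [:5 * j + 40:]"

fun cost_cmd :: "cmd \<Rightarrow> nat poly" where
  "cost_cmd (Set x s) = [:15, 8:]"
| "cost_cmd (Sq c d) = cost_cmd c + cost_cmd d + [:1:]"
| "cost_cmd (When \<phi> c) = cost \<phi> + cost_cmd c + [:3:]"
| "cost_cmd (For x c) = [:0, 1:] * (cost_cmd c + [:5:]) + [:10:]"

lemma valid_code: "wff k V \<phi> \<Longrightarrow> 4 \<le> k \<Longrightarrow> valid k (code \<phi>)"
proof (induction \<phi> arbitrary: V)
  case (Le c x j \<phi> \<psi>)
  have "valid k (repeat j (dec c))" if "c < k"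
    using that Le.prems by (induction j) (auto simp: dec_def)
  with Le show ?case by (auto simp: rewind_def dec_def)
qed (auto simp: find_entry_def rewind_def descend_def ascend_def skip_row_def)

lemma valid_code_cmd: "wfc k V c \<Longrightarrow> 4 \<le> k \<Longrightarrow> valid k (code_cmd c)"
  by (induction c arbitrary: V) (auto simp: rewind_def descend_def ascend_def valid_code)

text \<open>The values are \<^const>\<open>symbol_of\<close> of \<^const>\<open>Sep\<close>, \<^const>\<open>One\<close> and \<^const>\<open>Zero\<close>.\<close>

definition matrix :: "nat \<Rightarrow> (nat \<Rightarrow> nat \<Rightarrow> bool) \<Rightarrow> nat \<Rightarrow> nat" where
  "matrix n E p =
     (if p mod Suc n = n then 3 else if E (p div Suc n) (p mod Suc n) then 2 else 1)"

abbreviation matrix_tape :: "nat \<Rightarrow> (nat \<Rightarrow> nat \<Rightarrow> bool) \<Rightarrow> int \<Rightarrow> tape" where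
  "matrix_tape n E \<equiv> tp (n * Suc n) (matrix n E)"

lemma matrix_entry: "j < n \<Longrightarrow> matrix n E (i * Suc n + j) = (if E i j then 2 else 1)"
proof -
  assume "j < n"
  then have "(i * Suc n + j) mod Suc n = j" "(i * Suc n + j) div Suc n = i"
    by (simp_all only: mod_mult_self3 div_mult_self3) (simp_all)
  then show ?thesis using \<open>j < n\<close> unfolding matrix_def by simp
qed

lemma matrix_sep: "matrix n E (i * Suc n + n) = 3"
proof -
  have "(i * Suc n + n) mod Suc n = n"
    by (simp only: mod_mult_self3) simp
  then show ?thesis unfolding matrix_def by simp
qed

lemma entry_less: "i < n \<Longrightarrow> j \<le> n \<Longrightarrow> i * Suc n + j < n * Suc n"
proof -
  assume "i < n" "j \<le> n"
  then have "i * Suc n + j < Suc i * Suc n" by simp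
  also have "\<dots> \<le> n * Suc n" using \<open>i < n\<close> by (intro mult_right_mono) auto
  finally show ?thesis .
qed

lemma wp_skip_row:
  assumes "\<tau> 0 = matrix_tape n E (int (i * Suc n))" "i < n"
    and "Q (\<tau>(0 := matrix_tape n E (int (Suc i * Suc n))))"
  shows "wp skip_row (2 * n + 3) Q \<tau>"
proof -
  have "wp skip_row ((n * (1 + 1) + 1) + 1 + 1) Q \<tau>"
    unfolding skip_row_def
  proof (rule wp_Seq, rule wp_Until[where I = "\<lambda>j \<tau>'. \<tau>' = \<tau>(0 := matrix_tape n E (int (i * Suc n + j)))"])
    fix j \<tau>' assume j: "j < n" and \<tau>': "\<tau>' = \<tau>(0 := matrix_tape n E (int (i * Suc n + j)))"
    then show "scan (\<tau>' 0) \<noteq> 3 \<and>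
        wp (Go 0 Right) 1 (\<lambda>\<tau>'. \<tau>' = \<tau>(0 := matrix_tape n E (int (i * Suc n + Suc j)))) \<tau>'"
      using entry_less[OF assms(2), of j] matrix_entry[OF j, of E i]
      by (auto intro!: wp_simps simp del: mult_Suc_right of_nat_mult of_nat_add simp: nat_int_add)
        (simp add: algebra_simps)
  next
    fix \<tau>' assume \<tau>': "\<tau>' = \<tau>(0 := matrix_tape n E (int (i * Suc n + n)))"
    show "scan (\<tau>' 0) = 3 \<and> wp (Go 0 Right) 1 Q \<tau>'"
      using entry_less[OF assms(2), of n] matrix_sep[of n E i] assms(3)
      unfolding \<tau>' by (auto intro!: wp_simps simp del: mult_Suc_right of_nat_mult of_nat_add)
        (simp add: algebra_simps)
  qed (use assms in auto)
  then show ?thesis by (rule wp_mono) auto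
qed

lemma wp_find_entry:
  assumes tapes: "\<tau> 0 = matrix_tape n E 0" "\<tau> 3 = unary n 0" "\<tau> x = unary n (int a)" "\<tau> y = unary n (int b)"
    and ab: "a < n" "b < n" and xy: "4 \<le> x" "4 \<le> y"
    and Q: "Q (\<tau>(0 := matrix_tape n E (int (a * Suc n + b))))"
  shows "wp (find_entry x y) (2 * n * n + 22 * n + 23) Q \<tau>"
proof -
  have "wp (find_entry x y)
     ((a * (((2 * n + 3) + 1 + 1) + 3) + 3) + ((4 * a + 7) + ((b * ((1 + 1 + 1) + 3) + 3) + (4 * b + 7) + 1) + 1) + 1) Q \<tau>"
    unfolding find_entry_def
  proof (rule wp_Seq, rule wp_descend[where g = "\<lambda>j. \<tau>(0 := matrix_tape n E (int (j * Suc n)), 3 := unary n (int j))" and n = n])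
    fix j p assume j: "j < a"
    show "wp (skip_row ;; Go 3 Right) ((2 * n + 3) + 1 + 1)
        (\<lambda>\<tau>'. \<tau>' = (\<tau>(0 := matrix_tape n E (int (Suc j * Suc n)), 3 := unary n (int (Suc j))))(x := p))
        ((\<tau>(0 := matrix_tape n E (int (j * Suc n)), 3 := unary n (int j)))(x := p))"
      by (rule wp_Seq, rule wp_skip_row[of _ n E j], use xy j ab in simp, use j ab in simp, rule wp_Go)
        (use xy in \<open>auto simp: fun_eq_iff add.commute\<close>)
  next
    let ?\<tau> = "\<tau>(0 := matrix_tape n E (int (a * Suc n)))"
    show "wp (ascend x 3 ;; descend y (Go 0 Right ;; Go 3 Right) ;; ascend y 3)
        ((4 * a + 7) + ((b * ((1 + 1 + 1) + 3) + 3) + (4 * b + 7) + 1) + 1) Q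
        ((\<tau>(0 := matrix_tape n E (int (a * Suc n)), 3 := unary n (int a)))(x := unary n (- 1)))"
    proof (rule wp_Seq, rule wp_ascend[where n = n and l = n and h = a and m = "\<lambda>_. 1"], goal_cases)
      case 6
      have eq: "\<tau>(0 := matrix_tape n E (int (a * Suc n)), 3 := unary n (int a), x := unary n (- 1),
          x := unary n (int a), 3 := unary n 0) = ?\<tau>"
        using tapes xy by (auto simp: fun_eq_iff)
      show ?case
        unfolding eq
      proof (rule wp_Seq, rule wp_descend[where n = n and
            g = "\<lambda>j. \<tau>(0 := matrix_tape n E (int (a * Suc n + j)), 3 := unary n (int j))"])
        fix j p assume "j < b"
        show "wp (Go 0 Right ;; Go 3 Right) (1 + 1 + 1)
            (\<lambda>\<tau>'. \<tau>' = (\<tau>(0 := matrix_tape n E (int (a * Suc n + Suc j)), 3 := unary n (int (Suc j))))(y := p))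
            ((\<tau>(0 := matrix_tape n E (int (a * Suc n + j)), 3 := unary n (int j)))(y := p))"
          by (rule wp_Seq, rule wp_Go, rule wp_Go) (use xy in \<open>auto simp: fun_eq_iff algebra_simps\<close>)
      next
        have "\<tau>(0 := matrix_tape n E (int (a * Suc n + b)), 3 := unary n (int b), y := unary n (- 1),
            y := unary n (int b), 3 := unary n 0) = \<tau>(0 := matrix_tape n E (int (a * Suc n + b)))"
          using tapes xy by (auto simp: fun_eq_iff)
        then show "wp (ascend y 3) (4 * b + 7) Q
            ((\<tau>(0 := matrix_tape n E (int (a * Suc n + b)), 3 := unary n (int b)))(y := unary n (- 1)))"
          using Q ab xy by (intro wp_ascend[where n = n and l = n and h = b and m = "\<lambda>_. 1"]) auto
      qed (use tapes xy ab in \<open>auto simp: fun_eq_iff\<close>)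
    qed (use tapes xy ab in auto)
  qed (use tapes xy ab in \<open>auto simp: fun_eq_iff\<close>)
  moreover have "a * n \<le> n * n" using ab by simp
  then have "(a * (((2 * n + 3) + 1 + 1) + 3) + 3) + ((4 * a + 7) + ((b * ((1 + 1 + 1) + 3) + 3) + (4 * b + 7) + 1) + 1) + 1
      \<le> 2 * n * n + 22 * n + 23"
    using ab by (simp only: algebra_simps)
  ultimately show ?thesis
    by (rule wp_mono)
qed

text \<open>
  Tape 0 holds the input, tape 1 the marks, tape 2 the answer to the last query (2 for true, 1 for
  false), tape 3 is a scratch counter. The value of a variable \<open>v \<ge> 4\<close> is the head position on
  tape \<open>v\<close>, whose first \<open>n\<close> cells are nonblank so that both ends can be detected.
\<close>

definition represents :: "nat \<Rightarrow> nat \<Rightarrow> (nat \<Rightarrow> nat \<Rightarrow> bool) \<Rightarrow> nat set \<Rightarrow> (nat \<Rightarrow> nat) \<Rightarrow> (nat \<Rightarrow> nat) \<Rightarrow> mem \<Rightarrow> bool" where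
  "represents k n E V \<sigma> m \<tau> \<longleftrightarrow>
     \<tau> 0 = matrix_tape n E 0 \<and> \<tau> 1 = tp n m 0 \<and> \<tau> 3 = unary n 0 \<and> (\<forall>i<n. m i \<noteq> 0) \<and>
     (\<forall>v\<in>{4..<k}. \<exists>h\<le>n. \<tau> v = unary n (int h) \<and> (v \<in> V \<longrightarrow> h = \<sigma> v))"

lemma represents_put: "represents k n E V \<sigma> m \<tau> \<Longrightarrow> represents k n E V \<sigma> m (\<tau>(2 := t))"
  unfolding represents_def by auto

text \<open>A finished loop leaves the head of its variable at \<open>n\<close>, which is no vertex.
  Dropping the variable from \<open>V\<close> makes the position irrelevant and restores the old
  environment.\<close>

lemma represents_weaken: "represents k n E (insert x V) (\<sigma>(x := h)) m \<tau> \<Longrightarrow> x \<notin> V \<Longrightarrow> represents k n E V \<sigma> m \<tau>"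
  unfolding represents_def by (auto split: if_splits)

lemma represents_var:
  assumes "represents k n E V \<sigma> m \<tau>" "v \<in> V" "v \<in> {4..<k}"
  shows "\<tau> v = unary n (int (\<sigma> v))" "\<sigma> v \<le> n"
  using assms unfolding represents_def by blast+

lemma represents_upd:
  "represents k n E V \<sigma> m \<tau> \<Longrightarrow> x \<in> {4..<k} \<Longrightarrow> h \<le> n \<Longrightarrow>
     represents k n E (insert x V) (\<sigma>(x := h)) m (\<tau>(x := unary n (int h)))"
  unfolding represents_def by auto

lemma wp_represents_rewind:
  assumes "represents k n E V \<sigma> m \<tau>" "x \<in> {4..<k}"
    and "\<And>\<tau>'. represents k n E (insert x V) (\<sigma>(x := 0)) m \<tau>' \<Longrightarrow> Q \<tau>'"
  shows "wp (rewind x) (2 * n + 6) Q \<tau>"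
proof -
  obtain h where "h \<le> n" "\<tau> x = unary n (int h)"
    using assms(1,2) unfolding represents_def by blast
  then show ?thesis
    using assms(3)[OF represents_upd[OF assms(1,2), of 0]] by (intro wp_rewind) auto
qed

text \<open>\<open>S i\<close> and \<open>M i\<close> are environment and marks before round
  \<open>i\<close>; the environment may vary because a counter changes inside the loop.
  \<open>J\<close> is an extra invariant that must ignore the tape of the loop variable.\<close>

lemma wp_represents_loop:
  assumes "represents k n E (insert x V) ((S 0)(x := 0)) (M 0) \<tau>" "J 0 \<tau>" and x: "x \<in> {4..<k}"
    and body: "\<And>i \<tau>. i < n \<Longrightarrow> represents k n E (insert x V) ((S i)(x := i)) (M i) \<tau> \<Longrightarrow> J i \<tau> \<Longrightarrow>
      wp B T (\<lambda>\<tau>'. represents k n E (insert x V) ((S (Suc i))(x := i)) (M (Suc i)) \<tau>' \<and> J (Suc i) \<tau>') \<tau>"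
    and J: "\<And>i \<tau> t. J i \<tau> \<Longrightarrow> J i (\<tau>(x := t))"
    and Q: "\<And>\<tau>'. represents k n E (insert x V) ((S n)(x := n)) (M n) \<tau>' \<Longrightarrow> J n \<tau>' \<Longrightarrow> Q \<tau>'"
  shows "wp (Until x 0 (B ;; Go x Right)) (n * (T + 3) + 1) Q \<tau>"
proof -
  have "wp (Until x 0 (B ;; Go x Right)) (n * ((T + 1 + 1) + 1) + 1) Q \<tau>"
  proof (rule wp_Until[where I = "\<lambda>i \<tau>. represents k n E (insert x V) ((S i)(x := i)) (M i) \<tau> \<and> J i \<tau>"])
    fix i \<tau>' assume i: "i < n" and \<tau>': "represents k n E (insert x V) ((S i)(x := i)) (M i) \<tau>' \<and> J i \<tau>'"
    have "wp (B ;; Go x Right) (T + 1 + 1)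
        (\<lambda>\<tau>. represents k n E (insert x V) ((S (Suc i))(x := Suc i)) (M (Suc i)) \<tau> \<and> J (Suc i) \<tau>) \<tau>'"
    proof (rule wp_Seq, rule wp_mono[OF body[of i] order_refl], goal_cases)
      case (4 \<tau>1)
      then have "go Right (\<tau>1 x) = unary n (int (Suc i))"
        using represents_var(1)[OF _ _ x, of n E "insert x V" _ "M (Suc i)" \<tau>1] by (auto simp: add.commute)
      then show ?case
        using represents_upd[OF conjunct1[OF 4] x, of "Suc i"] 4 i J by (intro wp_Go) (auto simp: insert_absorb)
    qed (use i \<tau>' in auto)
    then show "scan (\<tau>' x) \<noteq> 0 \<and> wp (B ;; Go x Right) (T + 1 + 1)
        (\<lambda>\<tau>. represents k n E (insert x V) ((S (Suc i))(x := Suc i)) (M (Suc i)) \<tau> \<and> J (Suc i) \<tau>) \<tau>'"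
      using represents_var(1)[OF conjunct1[OF \<tau>'] _ x] i by auto
  next
    fix \<tau>' assume \<tau>': "represents k n E (insert x V) ((S n)(x := n)) (M n) \<tau>' \<and> J n \<tau>'"
    then show "scan (\<tau>' x) = 0 \<and> Q \<tau>'"
      using represents_var(1)[OF conjunct1[OF \<tau>'] _ x] Q by auto
  qed (use assms(1,2) in auto)
  then show ?thesis by (rule wp_mono) (auto simp: algebra_simps)
qed

text \<open>Needed for \<open>Le\<close>, where the counter changes its value in the environment
  while the subformulas are being evaluated.\<close>

lemma sat_cong: "(\<And>v. v \<in> fv \<phi> \<Longrightarrow> \<sigma> v = \<sigma>' v) \<Longrightarrow> sat n E m \<sigma> \<phi> = sat n E m \<sigma>' \<phi>"
proof (induction \<phi> arbitrary: \<sigma> \<sigma>')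
  case (Ex x \<phi>)
  have "sat n E m (\<sigma>(x := i)) \<phi> = sat n E m (\<sigma>'(x := i)) \<phi>" for i
    by (rule Ex.IH) (use Ex.prems in auto)
  then show ?case by simp
next
  case (Le c x j \<phi> \<psi>)
  have "sat n E m (\<sigma>(x := i)) \<phi> = sat n E m (\<sigma>'(x := i)) \<phi>" "sat n E m (\<sigma>(x := i)) \<psi> = sat n E m (\<sigma>'(x := i)) \<psi>"
    for i
    by (rule Le.IH; use Le.prems in auto)+
  then show ?case by simp
next
  case (Conj \<phi> \<psi>)
  have "sat n E m \<sigma> \<phi> = sat n E m \<sigma>' \<phi>" "sat n E m \<sigma> \<psi> = sat n E m \<sigma>' \<psi>"
    by (rule Conj.IH; use Conj.prems in auto)+
  then show ?case by simp
next
  case (Neg \<phi>)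
  have "sat n E m \<sigma> \<phi> = sat n E m \<sigma>' \<phi>"
    by (rule Neg.IH) (use Neg.prems in auto)
  then show ?case by simp
qed auto

lemma card_Suc_Collect:
  "card {j. j < Suc i \<and> P j} = card {j. j < i \<and> P j} + (if P i then 1 else 0)"
proof -
  have "{j. j < Suc i \<and> P j} = (if P i then insert i {j. j < i \<and> P j} else {j. j < i \<and> P j})"
    by (auto simp: less_Suc_eq)
  then show ?thesis by simp
qed

abbreviation decides :: "(mem \<Rightarrow> bool) \<Rightarrow> bool \<Rightarrow> mem \<Rightarrow> bool" where
  "decides I b \<equiv> \<lambda>\<tau>. I \<tau> \<and> scan (\<tau> 2) = (if b then 2 else 1)"

text \<open>The common frame of reading and writing a mark. The head of tape 1 itself records the
  value of \<open>x\<close>, and since marks are nonblank, \<open>ascend\<close> can read it back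
  after \<open>c\<close> has acted on the cell.\<close>

lemma wp_mark:
  assumes inv: "represents k n E V \<sigma> m \<tau>" and x: "x \<in> {4..<k}" "x \<in> V" "\<sigma> x < n"
    and c: "wp c T (\<lambda>\<tau>'. \<exists>m' t. \<tau>' = \<tau>(x := unary n (-1), 1 := tp n m' (int (\<sigma> x)), 2 := t) \<and>
         (\<forall>i<n. m' i \<noteq> 0) \<and> Q (\<tau>(1 := tp n m' 0, 2 := t)))
       (\<tau>(x := unary n (-1), 1 := tp n m (int (\<sigma> x))))"
  shows "wp (descend x (Go 1 Right) ;; c ;; ascend x 1) (8 * n + 12 + T) Q \<tau>"
proof -
  have t1: "\<tau> 1 = tp n m 0" using inv unfolding represents_def by auto
  have tx: "\<tau> x = unary n (int (\<sigma> x))" using represents_var[OF inv x(2,1)] by auto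
  have "wp (descend x (Go 1 Right) ;; c ;; ascend x 1)
      ((\<sigma> x * (1 + 3) + 3) + (T + (4 * \<sigma> x + 7) + 1) + 1) Q \<tau>"
  proof (rule wp_Seq, rule wp_descend[where n = n and g = "\<lambda>j. \<tau>(1 := tp n m (int j))"], goal_cases)
    case 4
    have eq: "\<tau>(1 := tp n m (int (\<sigma> x)), x := unary n (- 1)) = \<tau>(x := unary n (-1), 1 := tp n m (int (\<sigma> x)))"
      using x by (auto simp: fun_eq_iff)
    show ?case
      unfolding eq
    proof (rule wp_Seq, rule wp_mono[OF c order_refl], elim exE conjE)
      fix \<tau>' m' t
      assume \<tau>': "\<tau>' = \<tau>(x := unary n (-1), 1 := tp n m' (int (\<sigma> x)), 2 := t)" "\<forall>i<n. m' i \<noteq> 0"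
        "Q (\<tau>(1 := tp n m' 0, 2 := t))"
      have "\<tau>'(x := unary n (int (\<sigma> x)), 1 := tp n m' 0) = \<tau>(1 := tp n m' 0, 2 := t)"
        using x tx \<tau>'(1) by (auto simp: fun_eq_iff)
      then show "wp (ascend x 1) (4 * \<sigma> x + 7) Q \<tau>'"
        using \<tau>' x by (intro wp_ascend[where n = n and l = n and h = "\<sigma> x" and m = m']) auto
    qed
  qed (use t1 tx x in \<open>auto intro!: wp_simps simp: fun_eq_iff algebra_simps\<close>)
  then show ?thesis by (rule wp_mono) (use x in auto)
qed

lemma wp_answer:
  assumes "Q (\<tau>(2 := put (if scan (\<tau> i) = s then 2 else 1) (\<tau> 2)))"
  shows "wp (answer i s) 2 Q \<tau>"
proof -
  have "wp (answer i s) (1 + 1) Q \<tau>"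
    by (rule wp_Cond) (use assms in \<open>auto intro!: wp_simps\<close>)
  then show ?thesis by (simp add: numeral_2_eq_2)
qed

text \<open>The left neighbour of the current cell is blank exactly at position 0.\<close>

lemma wp_zero_test:
  assumes "\<tau> c = unary n (int h)" "h \<le> n" "c \<noteq> 2" "Q (\<tau>(2 := put (if h = 0 then 2 else 1) (\<tau> 2)))"
  shows "wp (Go c Left ;; answer c 0 ;; Go c Right) (1 + (2 + 1 + 1) + 1) Q \<tau>"
proof (rule wp_Seq, rule wp_Go, rule wp_Seq, rule wp_answer, rule wp_Go, goal_cases)
  case 1
  have "\<tau>(c := unary n (int h - 1), 2 := put (if h = 0 then 2 else 1) (\<tau> 2), c := unary n (int h)) =
      \<tau>(2 := put (if h = 0 then 2 else 1) (\<tau> 2))"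
    using assms(1,3) by (auto simp: fun_eq_iff)
  then show ?case
    using assms by (cases h) (auto simp: add.commute)
qed

section \<open>Correctness and running time of the generated programs\<close>

theorem wp_code:
  assumes "wff k V \<phi>" "\<forall>v\<in>fv \<phi>. v \<in> V \<and> \<sigma> v < n" "represents k n E V \<sigma> m \<tau>"
  shows "wp (code \<phi>) (poly (cost \<phi>) n) (decides (represents k n E V \<sigma> m) (sat n E m \<sigma> \<phi>)) \<tau>"
  using assms
proof (induction \<phi> arbitrary: V \<sigma> \<tau>)
  case (Adj x y)
  let ?Q = "decides (represents k n E V \<sigma> m) (sat n E m \<sigma> (Adj x y))"
  let ?p = "\<sigma> x * Suc n + \<sigma> y"
  have xy: "\<sigma> x < n" "\<sigma> y < n" "x \<in> {4..<k}" "y \<in> {4..<k}" "x \<in> V" "y \<in> V" using Adj.prems by auto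
  have p: "?p < n * Suc n" using entry_less[of "\<sigma> x" n "\<sigma> y"] xy by auto
  have t0: "\<tau> 0 = matrix_tape n E 0" "\<tau> 3 = unary n 0"
    using Adj.prems(3) unfolding represents_def by auto
  have "wp (code (Adj x y)) ((2 * n * n + 22 * n + 23) + (2 + (2 * (n * Suc n) + 6) + 1) + 1) ?Q \<tau>"
    unfolding code.simps
  proof (rule wp_Seq, rule wp_find_entry[where n = n and E = E and a = "\<sigma> x" and b = "\<sigma> y"], goal_cases)
    case 9
    let ?t = "put (if scan (matrix_tape n E (int ?p)) = 2 then 2 else 1) (\<tau> 2)"
    have t: "scan ?t = (if E (\<sigma> x) (\<sigma> y) then 2 else 1)"
      using p matrix_entry[OF xy(2), of E "\<sigma> x"] by (simp del: of_nat_add of_nat_mult mult_Suc_right)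
    show ?case
    proof (rule wp_Seq, rule wp_answer,
        rule wp_rewind[where n = "n * Suc n" and h = ?p and m = "matrix n E"], goal_cases)
      case 4
      have "\<tau>(0 := matrix_tape n E (int ?p), 2 := ?t, 0 := matrix_tape n E 0) = \<tau>(2 := ?t)"
        using t0 by (auto simp: fun_eq_iff)
      then show ?case
        using t represents_put[OF Adj.prems(3), of ?t] by simp
    qed (use p in \<open>auto simp: matrix_def\<close>)
  qed (use xy t0 represents_var[OF Adj.prems(3)] in auto)
  then show ?case
    by (rule wp_mono) (auto simp: algebra_simps)
next
  case (Mark x s)
  have x: "x \<in> {4..<k}" "x \<in> V" "\<sigma> x < n" using Mark.prems by auto
  have m: "\<forall>i<n. m i \<noteq> 0" "\<tau> 1 = tp n m 0" using Mark.prems unfolding represents_def by auto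
  have "wp (code (Mark x s)) (8 * n + 12 + 2) (decides (represents k n E V \<sigma> m) (sat n E m \<sigma> (Mark x s))) \<tau>"
    unfolding code.simps
  proof (rule wp_mark[OF Mark.prems(3) x], rule wp_answer,
      rule exI[of _ m], rule exI[of _ "put (if m (\<sigma> x) = s then 2 else 1) (\<tau> 2)"], intro conjI, goal_cases)
    case 3
    have "\<tau>(1 := tp n m 0) = \<tau>" using m by auto
    then show ?case using represents_put[OF Mark.prems(3)] by simp
  next
    case 4
    then show ?case by simp
  qed (use x m in \<open>auto simp: fun_eq_iff\<close>)
  then show ?case by (rule wp_mono) auto
next
  case (Neg \<phi>)
  have "wp (code (Neg \<phi>)) (poly (cost \<phi>) n + (1 + 1) + 1) (decides (represents k n E V \<sigma> m) (sat n E m \<sigma> (Neg \<phi>))) \<tau>"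
    unfolding code.simps
  proof (rule wp_Seq, rule wp_mono[OF Neg.IH[of V \<sigma>] order_refl], goal_cases)
    case (4 \<tau>')
    then show ?case by (intro wp_Cond) (auto intro!: wp_simps represents_put)
  qed (use Neg.prems in auto)
  then show ?case by (rule wp_mono) auto
next
  case (Conj \<phi> \<psi>)
  have "wp (code (Conj \<phi> \<psi>)) (poly (cost \<phi>) n + ((poly (cost \<psi>) n + 1) + 1) + 1)
     (decides (represents k n E V \<sigma> m) (sat n E m \<sigma> (Conj \<phi> \<psi>))) \<tau>"
    unfolding code.simps
  proof (rule wp_Seq, rule wp_mono[OF Conj.IH(1)[of V \<sigma>] order_refl], goal_cases)
    case (4 \<tau>')
    show ?case
    proof (rule wp_Cond, goal_cases)
      case 1
      with 4 show ?case using Conj.prems by (intro wp_mono[OF Conj.IH(2)[of V \<sigma> \<tau>']]) (auto split: if_splits)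
    next
      case 2
      with 4 show ?case by (intro wp_mono[OF wp_skip]) (auto split: if_splits)
    qed
  qed (use Conj.prems in auto)
  then show ?case by (rule wp_mono) auto
next
  case (Ex x \<phi>)
  let ?J = "\<lambda>i \<tau>. scan (\<tau> 2) = (if \<exists>j<i. sat n E m (\<sigma>(x := j)) \<phi> then 2 else 1)"
  have x: "x \<in> {4..<k}" "x \<notin> V" "x \<noteq> 2" using Ex.prems by auto
  have "wp (code (Ex x \<phi>)) ((2 * n + 6) + (1 + (n * (((poly (cost \<phi>) n + 1) + 1) + 3) + 1) + 1) + 1)
     (decides (represents k n E V \<sigma> m) (sat n E m \<sigma> (Ex x \<phi>))) \<tau>"
    unfolding code.simps
  proof (rule wp_Seq, rule wp_represents_rewind[OF Ex.prems(3) x(1)], rule wp_Seq, rule wp_Put,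
      rule wp_represents_loop[where S = "\<lambda>_. \<sigma>" and M = "\<lambda>_. m" and J = ?J and V = V])
    fix i \<tau>' assume i: "i < n" and \<tau>': "represents k n E (insert x V) (\<sigma>(x := i)) m \<tau>'" and J: "?J i \<tau>'"
    show "wp (Cond 2 2 skip (code \<phi>)) ((poly (cost \<phi>) n + 1) + 1)
       (\<lambda>\<tau>'. represents k n E (insert x V) (\<sigma>(x := i)) m \<tau>' \<and> ?J (Suc i) \<tau>') \<tau>'"
    proof (rule wp_Cond, goal_cases)
      case 1
      with \<tau>' J show ?case by (intro wp_mono[OF wp_skip]) (auto split: if_splits simp: less_Suc_eq)
    next
      case 2
      with \<tau>' J show ?case
        by (intro wp_mono[OF Ex.IH[of "insert x V" "\<sigma>(x := i)" \<tau>']])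
          (use i Ex.prems in \<open>auto split: if_splits simp: less_Suc_eq simp flip: fun_upd_def\<close>)
    qed
  qed (use x in \<open>auto intro: represents_put represents_weaken\<close>)
  then show ?case
    by (rule wp_mono) (auto simp: algebra_simps)
next
  case (Le c x j \<phi> \<psi>)
  let ?V = "insert c V"
  have x: "x \<in> {4..<k}" "x \<notin> V" "c \<in> {4..<k}" "c \<notin> V" "c \<noteq> x" "c \<notin> fv \<phi> \<union> fv \<psi>" using Le.prems by auto
  define N where "N \<theta> i = card {j. j < i \<and> sat n E m (\<sigma>(x := j)) \<theta>}" for \<theta> i
  have N: "N \<theta> 0 = 0" "N \<theta> (Suc i) = N \<theta> i + (if sat n E m (\<sigma>(x := i)) \<theta> then 1 else 0)" for \<theta> i
    by (simp_all add: N_def card_Suc_Collect)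
  have N_le: "N \<theta> i \<le> i" for \<theta> i
    unfolding N_def using card_mono[of "{..<i}" "{j. j < i \<and> sat n E m (\<sigma>(x := j)) \<theta>}"] by auto
  have coincide: "sat n E m (\<sigma>(c := a, x := i)) \<theta> = sat n E m (\<sigma>(x := i)) \<theta>" if "\<theta> = \<phi> \<or> \<theta> = \<psi>" for a i \<theta>
    by (rule sat_cong) (use that x in auto)
  \<comment> \<open>The counter after \<open>i\<close> rounds of the first and of the second loop;
    the difference is truncated, matching \<open>dec\<close>.\<close>
  let ?S1 = "\<lambda>i. \<sigma>(c := N \<phi> i)"
  let ?S2 = "\<lambda>i. \<sigma>(c := N \<phi> n - N \<psi> i)"
  \<comment> \<open>One round of either loop: \<open>d\<close> takes the counter from
    \<open>a\<close> to \<open>b\<close> if \<open>\<theta>\<close> holds, and otherwise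
    \<open>a = b\<close>.\<close>
  have eval: "wp (code \<theta> ;; Cond 2 2 d skip) (poly (cost \<theta>) n + (4 + 1) + 1)
      (represents k n E (insert x ?V) (\<sigma>(c := b, x := i)) m) \<tau>1"
    if "\<theta> = \<phi> \<or> \<theta> = \<psi>" "i < n" "represents k n E (insert x ?V) (\<sigma>(c := a, x := i)) m \<tau>1"
      and IH: "\<And>V \<sigma> \<tau>. wff k V \<theta> \<Longrightarrow> \<forall>v\<in>fv \<theta>. v \<in> V \<and> \<sigma> v < n \<Longrightarrow> represents k n E V \<sigma> m \<tau> \<Longrightarrow>
        wp (code \<theta>) (poly (cost \<theta>) n) (decides (represents k n E V \<sigma> m) (sat n E m \<sigma> \<theta>)) \<tau>"
      and d: "sat n E m (\<sigma>(x := i)) \<theta> \<Longrightarrow> (\<And>\<tau>2. represents k n E (insert x ?V) (\<sigma>(c := a, x := i)) m \<tau>2 \<Longrightarrow>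
        wp d 4 (represents k n E (insert x ?V) (\<sigma>(c := b, x := i)) m) \<tau>2)"
      and ab: "\<not> sat n E m (\<sigma>(x := i)) \<theta> \<Longrightarrow> a = b"
    for \<theta> d a b i \<tau>1
  proof (rule wp_Seq, rule wp_mono[OF IH[of "insert x ?V" "\<sigma>(c := a, x := i)" \<tau>1] order_refl], goal_cases)
    case 1
    then show ?case using that(1) Le.prems(1) by auto
  next
    case 2
    show ?case
      using that(1,2) Le.prems(2) x by auto
  next
    case 3
    then show ?case using that(3) by simp
  next
    case (4 \<tau>2)
    then show ?case
      unfolding coincide[OF that(1)]
      by (intro wp_Cond) (use d ab in \<open>auto split: if_splits intro: wp_mono[OF wp_skip]\<close>)
  qed
  have cvar: "\<tau>1 c = unary n (int a)" "a \<le> n" if "represents k n E (insert x ?V) (\<sigma>(c := a, x := i)) m \<tau>1" for \<tau>1 a i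
    using represents_var[OF that, of c] x by auto
  have cupd: "represents k n E (insert x ?V) (\<sigma>(c := b, x := i)) m (\<tau>1(c := unary n (int b)))"
    if "represents k n E (insert x ?V) (\<sigma>(c := a, x := i)) m \<tau>1" "b \<le> n" for \<tau>1 a b i
  proof -
    have "(\<sigma>(c := a, x := i))(c := b) = \<sigma>(c := b, x := i)" using x by auto
    then show ?thesis using represents_upd[OF that(1) x(3) that(2)] by (simp add: insert_absorb insert_commute)
  qed
  let ?B1 = "poly (cost \<phi>) n + (4 + 1) + 1" and ?B2 = "poly (cost \<psi>) n + (4 + 1) + 1"
  have "wp (code (Le c x j \<phi> \<psi>))
     ((2 * n + 6) + ((2 * n + 6) + ((n * (?B1 + 3) + 1) + ((2 * n + 6) + ((n * (?B2 + 3) + 1) +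
       ((5 * j + 1) + (1 + (2 + 1 + 1) + 1) + 1) + 1) + 1) + 1) + 1) + 1)
     (decides (represents k n E V \<sigma> m) (sat n E m \<sigma> (Le c x j \<phi> \<psi>))) \<tau>"
    unfolding code.simps
  proof (rule wp_Seq, rule wp_represents_rewind[OF Le.prems(3) x(3)],
      rule wp_Seq, rule wp_represents_rewind[OF _ x(1)], assumption,
      rule wp_Seq, rule wp_represents_loop[where k = k and E = E and V = ?V and S = ?S1 and M = "\<lambda>_. m" and J = "\<lambda>_ _. True"],
      goal_cases)
    case (4 \<tau>' \<tau>'' i \<tau>1)
    have "wp (code \<phi> ;; Cond 2 2 (Go c Right) skip) ?B1
        (represents k n E (insert x ?V) (\<sigma>(c := N \<phi> (Suc i), x := i)) m) \<tau>1"
    proof (rule eval[OF _ 4(3,4)])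
      fix \<tau>2 assume "sat n E m (\<sigma>(x := i)) \<phi>"
        and \<tau>2: "represents k n E (insert x ?V) (\<sigma>(c := N \<phi> i, x := i)) m \<tau>2"
      then have "N \<phi> (Suc i) = Suc (N \<phi> i)" by (simp add: N)
      then have "go Right (\<tau>2 c) = unary n (int (N \<phi> (Suc i)))" using cvar[OF \<tau>2] by (simp add: add.commute)
      moreover have "N \<phi> (Suc i) \<le> n" using N_le[of \<phi> "Suc i"] 4(3) by simp
      ultimately show "wp (Go c Right) 4 (represents k n E (insert x ?V) (\<sigma>(c := N \<phi> (Suc i), x := i)) m) \<tau>2"
        using cupd[OF \<tau>2, of "N \<phi> (Suc i)"] by (intro wp_mono[OF wp_Go]) auto
    qed (use Le.IH(1) in \<open>auto simp: N\<close>)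
    then show ?case by simp
  next
    case (6 \<tau>' \<tau>'' \<tau>1)
    then have \<tau>1: "represents k n E ?V (\<sigma>(c := N \<phi> n)) m \<tau>1"
      using x by (elim represents_weaken) auto
    show ?case
    proof (rule wp_Seq, rule wp_represents_rewind[OF \<tau>1 x(1)],
        rule wp_Seq, rule wp_represents_loop[where k = k and E = E and V = ?V and S = ?S2 and M = "\<lambda>_. m" and J = "\<lambda>_ _. True"],
        goal_cases)
      case (4 \<tau>3 i \<tau>1)
      have "wp (code \<psi> ;; Cond 2 2 (dec c) skip) ?B2
          (represents k n E (insert x ?V) (\<sigma>(c := N \<phi> n - N \<psi> (Suc i), x := i)) m) \<tau>1"
      proof (rule eval[OF _ 4(2,3)])
        fix \<tau>2 assume "sat n E m (\<sigma>(x := i)) \<psi>"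
          and \<tau>2: "represents k n E (insert x ?V) (\<sigma>(c := N \<phi> n - N \<psi> i, x := i)) m \<tau>2"
        then have "N \<phi> n - N \<psi> (Suc i) = N \<phi> n - N \<psi> i - 1" by (simp add: N)
        then show "wp (dec c) 4 (represents k n E (insert x ?V) (\<sigma>(c := N \<phi> n - N \<psi> (Suc i), x := i)) m) \<tau>2"
          using cupd[OF \<tau>2, of "N \<phi> n - N \<psi> (Suc i)"] cvar[OF \<tau>2] by (intro wp_dec) auto
      qed (use Le.IH(2) in \<open>auto simp: N\<close>)
      then show ?case by simp
    next
      case (6 \<tau>3 \<tau>4)
      let ?d = "N \<phi> n - N \<psi> n"
      have \<tau>4: "represents k n E (insert c V) (\<sigma>(c := ?d)) m \<tau>4"
        using 6(2) x by (elim represents_weaken) auto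
      have var: "\<tau>4 c = unary n (int ?d)" "?d \<le> n"
        using represents_var[OF \<tau>4, of c] x by auto
      show ?case
      proof (rule wp_Seq, rule wp_repeat_dec[where \<tau> = \<tau>4 and c = c and n = n and h = ?d, OF var], rule wp_zero_test[where c = c and n = n and h = "?d - j"], goal_cases)
        case 4
        let ?e = "?d - j"
        let ?t = "put (if ?e = 0 then 2 else 1) (\<tau>4 2)"
        have "represents k n E (insert c V) (\<sigma>(c := ?e)) m (\<tau>4(c := unary n (int ?e)))"
          using represents_upd[OF \<tau>4 x(3), of ?e] var(2) by simp
        then have "represents k n E V \<sigma> m (\<tau>4(c := unary n (int ?e), 2 := ?t))"
          using represents_weaken x(4) represents_put by blast
        moreover have "?e = 0 \<longleftrightarrow> sat n E m \<sigma> (Le c x j \<phi> \<psi>)"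
          by (auto simp: N_def)
        ultimately show ?case
          using x by (simp flip: fun_upd_def)
      qed (use x var in auto)
    qed (use N x in auto)
  qed (use N x in auto)
  then show ?case
    by (rule wp_mono) (auto simp: algebra_simps)
qed

theorem wp_code_cmd:
  assumes "wfc k V c" "\<forall>v\<in>fvc c. v \<in> V \<and> \<sigma> v < n" "represents k n E V \<sigma> m \<tau>"
  shows "wp (code_cmd c) (poly (cost_cmd c) n) (represents k n E V \<sigma> (exec n E c \<sigma> m)) \<tau>"
  using assms
proof (induction c arbitrary: V \<sigma> m \<tau>)
  case (Set x s)
  have x: "x \<in> {4..<k}" "x \<in> V" "\<sigma> x < n" using Set.prems by auto
  let ?m = "m(\<sigma> x := s)"
  have m: "\<forall>i<n. ?m i \<noteq> 0" using Set.prems unfolding represents_def by auto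
  have "wp (code_cmd (Set x s)) (8 * n + 12 + 1) (represents k n E V \<sigma> ?m) \<tau>"
    unfolding code_cmd.simps
  proof (rule wp_mark[OF Set.prems(3) x], rule wp_Put, rule exI[of _ ?m], rule exI[of _ "\<tau> 2"], intro conjI)
    show "represents k n E V \<sigma> ?m (\<tau>(1 := tp n ?m 0, 2 := \<tau> 2))"
      using Set.prems(3) m unfolding represents_def by auto
  qed (use x m put_tp[OF x(3), of s m] in \<open>auto simp: fun_eq_iff\<close>)
  then show ?case by (rule wp_mono) (auto simp flip: fun_upd_def)
next
  case (Sq c d)
  have "wp (code_cmd (Sq c d)) (poly (cost_cmd c) n + poly (cost_cmd d) n + 1)
      (represents k n E V \<sigma> (exec n E (Sq c d) \<sigma> m)) \<tau>"
    unfolding code_cmd.simps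
  proof (rule wp_Seq, rule wp_mono[OF Sq.IH(1)[of V \<sigma> m] order_refl], goal_cases)
    case (4 \<tau>')
    then show ?case using Sq.IH(2)[of V \<sigma> "exec n E c \<sigma> m"] Sq.prems by auto
  qed (use Sq.prems in auto)
  then show ?case by (auto elim: wp_mono)
next
  case (When \<phi> c)
  have "wp (code_cmd (When \<phi> c)) (poly (cost \<phi>) n + ((poly (cost_cmd c) n + 1) + 1) + 1)
      (represents k n E V \<sigma> (exec n E (When \<phi> c) \<sigma> m)) \<tau>"
    unfolding code_cmd.simps
  proof (rule wp_Seq, rule wp_mono[OF wp_code[of k V \<phi> \<sigma> n E m] order_refl], goal_cases)
    case (4 \<tau>')
    show ?case
    proof (rule wp_Cond, goal_cases)
      case 1
      with 4 When.prems When.IH[of V \<sigma> m \<tau>'] show ?case by (auto split: if_splits elim!: wp_mono)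
    next
      case 2
      with 4 show ?case by (intro wp_mono[OF wp_skip]) (auto split: if_splits)
    qed
  qed (use When.prems in auto)
  then show ?case by (rule wp_mono) auto
next
  case (For x c)
  let ?M = "\<lambda>j. fold (\<lambda>i. exec n E c (\<sigma>(x := i))) [0..<j] m"
  have x: "x \<in> {4..<k}" "x \<notin> V" using For.prems by auto
  have "wp (code_cmd (For x c)) ((2 * n + 6) + (n * (poly (cost_cmd c) n + 3) + 1) + 1)
      (represents k n E V \<sigma> (exec n E (For x c) \<sigma> m)) \<tau>"
    unfolding code_cmd.simps
  proof (rule wp_Seq, rule wp_represents_rewind[OF For.prems(3) x(1)],
      rule wp_represents_loop[where k = k and E = E and V = V and S = "\<lambda>_. \<sigma>" and M = ?M and J = "\<lambda>_ _. True"], goal_cases)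
    case (4 \<tau>' i \<tau>1)
    then show ?case
      using For.prems by (intro wp_mono[OF For.IH[of "insert x V" "\<sigma>(x := i)" "?M i"]]) (auto simp flip: fun_upd_def)
  next
    case (6 \<tau>' \<tau>'')
    then show ?case using x by (auto intro: represents_weaken)
  qed (use x in auto)
  then show ?case
    by (rule wp_mono) (auto simp: algebra_simps)
qed

section \<open>Stability of cographs by deleting classes of false twins\<close>

context
  fixes E :: "'a \<Rightarrow> 'a \<Rightarrow> bool"
begin

definition indep :: "'a set \<Rightarrow> 'a set \<Rightarrow> bool" where
  "indep A S \<longleftrightarrow> S \<subseteq> A \<and> (\<forall>u\<in>S. \<forall>v\<in>S. \<not> E u v)"

definition max_indep :: "'a set \<Rightarrow> 'a set \<Rightarrow> bool" where
  "max_indep A S \<longleftrightarrow> indep A S \<and> (\<forall>T. indep A T \<longrightarrow> card T \<le> card S)"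

text \<open>
  A vertex of \<open>B\<close> stands for a module whose independence number grows when some edge inside the
  module is deleted.
\<close>

definition marked_stable :: "'a set \<Rightarrow> 'a set \<Rightarrow> bool" where
  "marked_stable A B \<longleftrightarrow>
     (\<forall>u v S. E u v \<longrightarrow> u \<notin> S \<longrightarrow> v \<notin> S \<longrightarrow> max_indep A (insert u S) \<longrightarrow> \<not> max_indep A (insert v S)) \<and>
     (\<forall>S. max_indep A S \<longrightarrow> S \<inter> B = {})"

text \<open>For adjacent \<open>x\<close> and \<open>y\<close> in \<open>A\<close> this contains
  \<open>x\<close> itself, as \<open>x\<close> is a neighbour of \<open>y\<close> and not of itself.
  In a twin pair it is the class of \<open>x\<close> that is a candidate for deletion.\<close>

definition private_nbrs :: "'a set \<Rightarrow> 'a \<Rightarrow> 'a \<Rightarrow> 'a set" where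
  "private_nbrs A x y = {k \<in> A. E k y \<and> \<not> E k x}"

definition twin_pair :: "'a set \<Rightarrow> 'a \<Rightarrow> 'a \<Rightarrow> bool" where
  "twin_pair A x y \<longleftrightarrow> x \<in> A \<and> y \<in> A \<and> E x y \<and>
     (\<forall>k\<in>private_nbrs A x y. \<forall>l\<in>A. E k l = E x l) \<and>
     (\<forall>k\<in>private_nbrs A y x. \<forall>l\<in>A. E k l = E y l)"

text \<open>Used only when the class of \<open>x\<close> is not the larger one, so the first
  conjunct amounts to equal sizes.\<close>

definition new_mark :: "'a set \<Rightarrow> 'a set \<Rightarrow> 'a \<Rightarrow> 'a \<Rightarrow> bool" where
  "new_mark A B x y \<longleftrightarrow> card (private_nbrs A y x) \<le> card (private_nbrs A x y) \<and>
     (card (private_nbrs A x y) \<le> 1 \<or> private_nbrs A x y \<inter> B \<noteq> {})"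

end

locale irreflexive_graph =
  fixes E :: "'a \<Rightarrow> 'a \<Rightarrow> bool"
  assumes sym: "E u v \<Longrightarrow> E v u" and irrefl: "\<not> E u u"
begin

section \<open>Exchanging the two classes in a maximum independent set\<close>

lemma max_indep_mono:
  assumes "max_indep E A S" "S \<subseteq> A'" "A' \<subseteq> A"
  shows "max_indep E A' S"
  using assms unfolding max_indep_def indep_def by (meson order_trans)

lemma max_indep_card:
  assumes "max_indep E A S" "indep E A T" "card S \<le> card T"
  shows "max_indep E A T"
  using assms unfolding max_indep_def by (meson order_trans)

text \<open>
  As \<open>S\<close> contains a false twin of \<open>x\<close>, it avoids \<open>N(x)\<close>. Outside of the two classes, \<open>x\<close> and \<open>y\<close>
  have the same neighbours, so the class of \<open>y\<close> can take the place of the class of \<open>x\<close>.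
\<close>

lemma max_indep_swap:
  assumes "finite A" "twin_pair E A x y" and S: "max_indep E A S"
    and meets: "S \<inter> private_nbrs E A x y \<noteq> {}"
    and card: "card (private_nbrs E A x y) \<le> card (private_nbrs E A y x)"
  shows "private_nbrs E A x y \<subseteq> S" "S \<inter> private_nbrs E A y x = {}"
    "max_indep E A (S - private_nbrs E A x y \<union> private_nbrs E A y x)"
    "card (private_nbrs E A x y) = card (private_nbrs E A y x)"
proof -
  let ?X = "private_nbrs E A x y" and ?Y = "private_nbrs E A y x"
  have X: "k \<in> A" "E k y" "\<not> E k x" if "k \<in> ?X" for k
    using that by (auto simp: private_nbrs_def)
  have Y: "k \<in> A" "E k x" "\<not> E k y" if "k \<in> ?Y" for k
    using that by (auto simp: private_nbrs_def)
  have xy: "x \<in> A" "y \<in> A" "E x y" using assms(2) by (auto simp: twin_pair_def)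
  have EX: "E k l = E x l" if "k \<in> ?X" "l \<in> A" for k l
    using assms(2) that by (auto simp: twin_pair_def)
  have EY: "E k l = E y l" if "k \<in> ?Y" "l \<in> A" for k l
    using assms(2) that by (auto simp: twin_pair_def)
  have SA: "S \<subseteq> A" and ind: "\<And>u v. u \<in> S \<Longrightarrow> v \<in> S \<Longrightarrow> \<not> E u v"
    using S by (auto simp: max_indep_def indep_def)
  have fin: "finite S" "finite ?X" "finite ?Y"
    using assms(1) SA by (auto simp: private_nbrs_def intro: finite_subset)
  obtain s where s: "s \<in> S" "s \<in> ?X" using meets by blast
  have noX: "\<not> E x l" if "l \<in> S" for l
    using EX[OF s(2)] ind[OF s(1) that] SA that by blast
  have noX': "\<not> E l x" if "l \<in> S" for l using noX[OF that] sym by blast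
  \<comment> \<open>Vertices of \<open>X\<close> are nonneighbours of \<open>x\<close> with the same
    neighbours as \<open>x\<close>, and \<open>S\<close> avoids \<open>N(x)\<close>; so adding all
    of \<open>X\<close> creates no edge, and maximality forces \<open>X\<close> into
    \<open>S\<close>.\<close>
  have "indep E A (S \<union> ?X)"
    unfolding indep_def
  proof (intro conjI ballI)
    fix a b assume ab: "a \<in> S \<union> ?X" "b \<in> S \<union> ?X"
    have none: "\<not> E x l" if "l \<in> S \<union> ?X" for l using that noX X(3) sym by blast
    have "a \<in> A" "b \<in> A" using ab SA X(1) by blast+
    then show "\<not> E a b"
      using ab ind[of a b] EX[of a b] EX[of b a] none[of a] none[of b] sym[of a b] by blast
  qed (use SA X(1) in blast)
  then have "card (S \<union> ?X) \<le> card S" using S by (auto simp: max_indep_def)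
  then have "S = S \<union> ?X" using fin by (intro card_seteq) auto
  then show XS: "?X \<subseteq> S" by blast
  show SY: "S \<inter> ?Y = {}" using noX' Y by blast
  have "indep E A (S - ?X \<union> ?Y)"
  proof -
    \<comment> \<open>A neighbour of \<open>y\<close> in \<open>S\<close> is no neighbour of
      \<open>x\<close>, hence lies in \<open>X\<close>.\<close>
    have noY: "\<not> E y l" if "l \<in> S - ?X" for l
      using that noX' SA X sym unfolding private_nbrs_def by blast
    show ?thesis
      unfolding indep_def
    proof (intro conjI ballI)
      fix a b assume ab: "a \<in> S - ?X \<union> ?Y" "b \<in> S - ?X \<union> ?Y"
      have none: "\<not> E y l" if "l \<in> S - ?X \<union> ?Y" for l using that noY Y(3) sym by blast
      have "a \<in> A" "b \<in> A" using ab SA Y(1) by blast+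
      then show "\<not> E a b"
        using ab ind[of a b] EY[of a b] EY[of b a] none[of a] none[of b] sym[of a b] by blast
    qed (use SA Y(1) in blast)
  qed
  moreover have eq: "card (S - ?X \<union> ?Y) = card S - card ?X + card ?Y"
  proof -
    have "card (S - ?X \<union> ?Y) = card (S - ?X) + card ?Y"
      using fin SY by (intro card_Un_disjoint) auto
    then show ?thesis using XS fin by (simp add: card_Diff_subset)
  qed
  ultimately show "max_indep E A (S - ?X \<union> ?Y)"
    using S card card_mono[OF fin(1) XS] by (intro max_indep_card[OF S]) auto
  \<comment> \<open>The exchanged set cannot exceed a maximum one, which turns the assumed
    inequality of sizes into an equality.\<close>
  have "card S - card ?X + card ?Y \<le> card S"
    using S \<open>indep E A (S - ?X \<union> ?Y)\<close> eq by (auto simp: max_indep_def)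
  then show "card ?X = card ?Y" using card card_mono[OF fin(1) XS] by linarith
qed

lemma twin_pair_sym: "twin_pair E A x y \<Longrightarrow> twin_pair E A y x"
  unfolding twin_pair_def using sym[of x y] by blast

text \<open>The maximum sets of \<open>A - X\<close> are the maximum sets of \<open>A\<close> that
  avoid \<open>X\<close>. What the deletion loses are the maximum sets meeting \<open>X\<close>;
  each of them trades \<open>X\<close> for \<open>Y\<close>, so the mark on \<open>y\<close> can
  account for them.\<close>

theorem marked_stable_delete:
  assumes fin: "finite A" and pair: "twin_pair E A x y"
    and le: "card (private_nbrs E A x y) \<le> card (private_nbrs E A y x)"
  shows "marked_stable E A B \<longleftrightarrow>
    marked_stable E (A - private_nbrs E A x y)
      ((if new_mark E A B x y then insert y B else B) - private_nbrs E A x y)"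
    (is "_ \<longleftrightarrow> marked_stable E ?A' ?B'")
proof
  let ?X = "private_nbrs E A x y" and ?Y = "private_nbrs E A y x"
  have xy: "x \<in> ?X" "y \<in> ?Y" "E x y" "y \<notin> ?X"
    using pair irrefl[of x] irrefl[of y] sym[of x y] unfolding twin_pair_def private_nbrs_def by blast+
  have finXY: "finite ?X" "finite ?Y" using fin by (auto simp: private_nbrs_def)
  have disj: "?X \<inter> ?Y = {}" by (auto simp: private_nbrs_def)
  have one: "card ?X \<ge> 1" using xy(1) finXY by (metis One_nat_def Suc_leI card_gt_0_iff empty_iff)
  \<comment> \<open>The exchange makes some maximum set of \<open>A\<close> avoid \<open>X\<close>,
    so \<open>A\<close> and \<open>A - X\<close> have the same independence number.\<close>
  have up: "max_indep E A S" if "max_indep E ?A' S" for S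
  proof -
    have S: "indep E A S" using that by (auto simp: max_indep_def indep_def)
    have "card T \<le> card S" if T: "indep E A T" for T
    proof -
      have fins: "finite {card T | T. indep E A T}"
      proof -
        have "{card T | T. indep E A T} \<subseteq> card ` Pow A" by (auto simp: indep_def)
        then show ?thesis using fin by (meson finite_Pow_iff finite_imageI finite_subset)
      qed
      obtain M where M: "max_indep E A M"
      proof -
        have "Max {card T | T. indep E A T} \<in> {card T | T. indep E A T}"
          using fins T by (intro Max_in) auto
        then obtain M where "indep E A M" "card M = Max {card T | T. indep E A T}" by force
        then have "max_indep E A M" unfolding max_indep_def using fins by (auto intro!: Max_ge)
        then show ?thesis using that by blast
      qed
      define M' where "M' = (if M \<inter> ?X = {} then M else M - ?X \<union> ?Y)"
      have M': "max_indep E A M'" "M' \<inter> ?X = {}"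
        using max_indep_swap[OF fin pair M _ le] M disj by (auto simp: M'_def)
      then have "indep E ?A' M'" by (auto simp: max_indep_def indep_def)
      then show ?thesis
        using \<open>max_indep E ?A' S\<close> M'(1) T unfolding max_indep_def by (meson order_trans)
    qed
    then show ?thesis using S by (auto simp: max_indep_def)
  qed
  have down: "max_indep E ?A' S" if "max_indep E A S" "S \<inter> ?X = {}" for S
    using that by (intro max_indep_mono[OF that(1)]) (auto simp: max_indep_def indep_def)
  show "marked_stable E ?A' ?B'" if st: "marked_stable E A B"
    unfolding marked_stable_def
  proof (intro conjI allI impI)
    fix u v S assume "E u v" "u \<notin> S" "v \<notin> S" "max_indep E ?A' (insert u S)"
    then show "\<not> max_indep E ?A' (insert v S)"
      using st up unfolding marked_stable_def by blast
  next
    fix S assume S: "max_indep E ?A' S"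
    then have SB: "S \<inter> B = {}" using st up unfolding marked_stable_def by blast
    show "S \<inter> ?B' = {}"
    proof (rule ccontr)
      assume "S \<inter> ?B' \<noteq> {}"
      then have new: "new_mark E A B x y" and y: "y \<in> S"
        using SB by (auto split: if_splits)
      have eq: "card ?Y \<le> card ?X" using new by (auto simp: new_mark_def)
      \<comment> \<open>The roles of \<open>x\<close> and \<open>y\<close> are reversed here:
        \<open>S\<close> contains \<open>y\<close>, and \<open>new_mark\<close> supplies the
        comparison of sizes for trading \<open>Y\<close> for \<open>X\<close>.\<close>
      have swap: "?Y \<subseteq> S" "max_indep E A (S - ?Y \<union> ?X)"
        using max_indep_swap[OF fin twin_pair_sym[OF pair] up[OF S] _ eq] y xy by auto
      show False
      proof (cases "?X \<inter> B = {}")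
        case True
        then have "card ?X = 1" "card ?Y = 1"
          using new one eq le by (auto simp: new_mark_def)
        then have "?X = {x}" "?Y = {y}" using xy by (metis card_1_singletonE singletonD)+
        \<comment> \<open>Two maximum sets that differ only in \<open>x\<close> and \<open>y\<close>
          contradict stability at the edge \<open>xy\<close>.\<close>
        then have "max_indep E A (insert x (S - {y}))" "max_indep E A (insert y (S - {y}))"
          using swap up[OF S] y by (auto simp: insert_absorb)
        moreover have "x \<notin> S" using S xy(1) by (auto simp: max_indep_def indep_def)
        ultimately show False
          using st xy unfolding marked_stable_def by blast
      next
        case False
        then show False using swap(2) st unfolding marked_stable_def by blast
      qed
    qed
  qed
  show "marked_stable E A B" if st: "marked_stable E ?A' ?B'"
  proof -
    have st1: "\<not> max_indep E ?A' (insert v S)" if "E u v" "u \<notin> S" "v \<notin> S" "max_indep E ?A' (insert u S)" for u v S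
      using st that unfolding marked_stable_def by blast
    have st2: "S \<inter> ?B' = {}" if "max_indep E ?A' S" for S
      using st that unfolding marked_stable_def by blast
    \<comment> \<open>After the exchange the set contains \<open>y\<close>, which is marked in the
      reduced graph.\<close>
    have no_new: "S \<inter> ?X = {}" if new: "new_mark E A B x y" and S: "max_indep E A S" for S
    proof (rule ccontr)
      assume "S \<inter> ?X \<noteq> {}"
      then have "max_indep E A (S - ?X \<union> ?Y)" using max_indep_swap[OF fin pair S _ le] by blast
      then have "max_indep E ?A' (S - ?X \<union> ?Y)" using disj by (intro down) auto
      then show False using st2 new xy by auto
    qed
    show ?thesis
      unfolding marked_stable_def
    proof (intro conjI allI impI notI)
      fix u v S
      assume uv: "E u v" "u \<notin> S" "v \<notin> S" and max: "max_indep E A (insert u S)" "max_indep E A (insert v S)"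
      have neq: "u \<noteq> v" using uv irrefl by auto
      \<comment> \<open>If \<open>S\<close> meets \<open>X\<close>, both sets contain
        \<open>X\<close>, so \<open>u\<close> and \<open>v\<close> lie outside both classes and the
        exchange keeps the critical edge. If only \<open>u\<close> or \<open>v\<close> lies in
        \<open>X\<close>, then \<open>X\<close> is a singleton, which triggers the new mark.
        Otherwise both sets survive the deletion unchanged.\<close>
      consider "S \<inter> ?X \<noteq> {}" | "S \<inter> ?X = {}" "u \<in> ?X \<or> v \<in> ?X" | "insert u S \<inter> ?X = {}" "insert v S \<inter> ?X = {}"
        by blast
      then show False
      proof cases
        case 1
        then have ne: "insert u S \<inter> ?X \<noteq> {}" "insert v S \<inter> ?X \<noteq> {}" by auto
        note swu = max_indep_swap[OF fin pair max(1) ne(1) le] and swv = max_indep_swap[OF fin pair max(2) ne(2) le]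
        have out: "u \<notin> ?X" "v \<notin> ?X" "u \<notin> ?Y" "v \<notin> ?Y"
          using swu(1,2) swv(1,2) neq uv(2,3) by auto
        then have "insert u S - ?X \<union> ?Y = insert u (S - ?X \<union> ?Y)" "insert v S - ?X \<union> ?Y = insert v (S - ?X \<union> ?Y)"
          by auto
        then have "max_indep E ?A' (insert u (S - ?X \<union> ?Y))" "max_indep E ?A' (insert v (S - ?X \<union> ?Y))"
          using swu(3) swv(3) disj out(1,2) by (auto intro!: down)
        then show False
          using st1[OF uv(1), of "S - ?X \<union> ?Y"] uv out by auto
      next
        case 2
        then obtain w where w: "w \<in> ?X" "max_indep E A (insert w S)" using max by blast
        note sw = max_indep_swap[OF fin pair w(2) _ le]
        have "?X = {w}" using sw(1) 2(1) w(1) by blast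
        then have "new_mark E A B x y"
          using sw(4) w(1) by (auto simp: new_mark_def)
        then show False using no_new[OF _ w(2)] w(1) by blast
      next
        case 3
        then show False
          using st1[OF uv down[OF max(1)]] down[OF max(2)] by simp
      qed
    next
      fix S assume S: "max_indep E A S"
      show "S \<inter> B = {}"
      proof (cases "S \<inter> ?X = {}")
        case True
        then show ?thesis using st2[OF down[OF S]] by (auto split: if_splits)
      next
        case False
        note sw = max_indep_swap[OF fin pair S False le]
        have "max_indep E ?A' (S - ?X \<union> ?Y)" using sw(3) disj by (intro down) auto
        from st2[OF this] have "(S - ?X) \<inter> B = {}" by (auto split: if_splits)
        \<comment> \<open>Since \<open>S\<close> meets \<open>X\<close>, the sizes agree; an old
          mark in \<open>X\<close> would therefore have produced the new mark.\<close>
        moreover have "?X \<inter> B = {}"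
        proof (rule ccontr)
          assume "?X \<inter> B \<noteq> {}"
          then have "new_mark E A B x y" using sw(4) by (simp add: new_mark_def)
          then show False using no_new[OF _ S] False by blast
        qed
        ultimately show ?thesis using sw(1) by blast
      qed
    qed
  qed
qed

lemma marked_stable_edgeless:
  assumes "finite A" "\<And>u v. u \<in> A \<Longrightarrow> v \<in> A \<Longrightarrow> \<not> E u v"
  shows "marked_stable E A B \<longleftrightarrow> A \<inter> B = {}"
proof -
  have "indep E A A" using assms(2) by (simp add: indep_def)
  moreover have "card T \<le> card A" if "indep E A T" for T
    using that assms(1) by (simp add: indep_def card_mono)
  ultimately have A: "max_indep E A A" by (simp add: max_indep_def)
  have only: "S = A" if "max_indep E A S" for S
  proof (rule card_seteq)
    show "S \<subseteq> A" using that by (simp add: max_indep_def indep_def)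
    show "card A \<le> card S" using that A by (simp add: max_indep_def)
  qed (rule assms(1))
  show ?thesis
    unfolding marked_stable_def
  proof (intro iffI conjI allI impI notI)
    fix u v S assume "E u v" "max_indep E A (insert u S)" "max_indep E A (insert v S)"
    then show False using only assms(2) by (metis insertI1)
  qed (use A only in auto)
qed

end

text \<open>A vertex outside the module \<open>M\<close> sees \<open>x\<close> and \<open>y\<close>
  alike, so it is private to neither, and it cannot distinguish twins inside \<open>M\<close>.
  \<open>E'\<close> is a separate relation because the edges of one side of a join agree with those
  of the join only within that side.\<close>

lemma twin_pair_module:
  assumes "twin_pair E' M x y" "M \<subseteq> A"
    and agree: "\<And>a b. a \<in> M \<Longrightarrow> b \<in> M \<Longrightarrow> E a b = E' a b"
    and outside: "\<And>k a b. k \<in> A \<Longrightarrow> k \<notin> M \<Longrightarrow> a \<in> M \<Longrightarrow> b \<in> M \<Longrightarrow> E k a = E k b \<and> E a k = E b k"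
  shows "twin_pair E A x y"
proof -
  have xy: "x \<in> M" "y \<in> M" "E' x y"
    and X: "\<And>k l. k \<in> private_nbrs E' M x y \<Longrightarrow> l \<in> M \<Longrightarrow> E' k l = E' x l"
    and Y: "\<And>k l. k \<in> private_nbrs E' M y x \<Longrightarrow> l \<in> M \<Longrightarrow> E' k l = E' y l"
    using assms(1) unfolding twin_pair_def by blast+
  have priv: "k \<in> private_nbrs E' M a b" if "k \<in> private_nbrs E A a b" "a \<in> M" "b \<in> M" for k a b
    using that agree outside[of k a b] unfolding private_nbrs_def by auto
  have "E k l = E x l" if "k \<in> private_nbrs E A x y" "l \<in> A" for k l
  proof (cases "l \<in> M")
    case True
    then show ?thesis
      using X[OF priv[OF that(1) xy(1,2)] True] priv[OF that(1) xy(1,2)] xy agree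
      by (simp add: private_nbrs_def)
  next
    case False
    then show ?thesis
      using outside[OF that(2) False, of k x] priv[OF that(1) xy(1,2)] xy by (simp add: private_nbrs_def)
  qed
  moreover have "E k l = E y l" if "k \<in> private_nbrs E A y x" "l \<in> A" for k l
  proof (cases "l \<in> M")
    case True
    then show ?thesis
      using Y[OF priv[OF that(1) xy(2,1)] True] priv[OF that(1) xy(2,1)] xy agree
      by (simp add: private_nbrs_def)
  next
    case False
    then show ?thesis
      using outside[OF that(2) False, of k y] priv[OF that(1) xy(2,1)] xy by (simp add: private_nbrs_def)
  qed
  ultimately show ?thesis
    using xy agree assms(2) unfolding twin_pair_def by auto
qed

text \<open>
  Each side of a union or join is a module, so a pair found inside one side remains one. If no edge
  of a join lies inside a side, any edge across is such a pair.
\<close>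

lemma cograph_twin_pair:
  assumes "cograph G" "A \<subseteq> verts G" "u \<in> A" "v \<in> A" "{u, v} \<in> edges G"
  shows "\<exists>x y. twin_pair (\<lambda>u v. {u, v} \<in> edges G) A x y"
  using assms
proof (induction arbitrary: A u v rule: cograph.induct)
  case (single w)
  then show ?case by auto
next
  case (union G H)
  have inG: "a \<in> verts G \<and> b \<in> verts G" if "{a, b} \<in> edges G" for a b
    using cograph_imp_simple_graph[OF union.hyps(1)] that unfolding simple_graph_def by blast
  have inH: "a \<in> verts H \<and> b \<in> verts H" if "{a, b} \<in> edges H" for a b
    using cograph_imp_simple_graph[OF union.hyps(2)] that unfolding simple_graph_def by blast
  have edge: "{a, b} \<in> edges (graph_union G H) \<longleftrightarrow> {a, b} \<in> edges G \<or> {a, b} \<in> edges H" for a b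
    by (simp add: graph_union_def)
  consider "{u, v} \<in> edges G" | "{u, v} \<in> edges H" using union.prems by (auto simp: graph_union_def)
  then show ?case
  proof cases
    case 1
    then obtain x y where "twin_pair (\<lambda>u v. {u, v} \<in> edges G) (A \<inter> verts G) x y"
      using union.IH(1)[of "A \<inter> verts G" u v] inG union.prems by auto
    then have "twin_pair (\<lambda>u v. {u, v} \<in> edges (graph_union G H)) A x y"
      unfolding edge by (rule twin_pair_module) (use inG inH union.hyps(3) in blast)+
    then show ?thesis by blast
  next
    case 2
    then obtain x y where "twin_pair (\<lambda>u v. {u, v} \<in> edges H) (A \<inter> verts H) x y"
      using union.IH(2)[of "A \<inter> verts H" u v] inH union.prems by auto
    then have "twin_pair (\<lambda>u v. {u, v} \<in> edges (graph_union G H)) A x y"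
      unfolding edge by (rule twin_pair_module) (use inG inH union.hyps(3) in blast)+
    then show ?thesis by blast
  qed
next
  case (join G H)
  have inG: "a \<in> verts G \<and> b \<in> verts G" if "{a, b} \<in> edges G" for a b
    using cograph_imp_simple_graph[OF join.hyps(1)] that unfolding simple_graph_def by blast
  have inH: "a \<in> verts H \<and> b \<in> verts H" if "{a, b} \<in> edges H" for a b
    using cograph_imp_simple_graph[OF join.hyps(2)] that unfolding simple_graph_def by blast
  have edge: "{a, b} \<in> edges (graph_join G H) \<longleftrightarrow> {a, b} \<in> edges G \<or> {a, b} \<in> edges H \<or>
      a \<in> verts G \<and> b \<in> verts H \<or> a \<in> verts H \<and> b \<in> verts G" for a b
    unfolding graph_join_def by (auto simp: doubleton_eq_iff)
  have sub: "A \<subseteq> verts G \<union> verts H" using join.prems by (auto simp: graph_join_def)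
  consider (G) a b where "a \<in> A" "b \<in> A" "{a, b} \<in> edges G" | (H) a b where "a \<in> A" "b \<in> A" "{a, b} \<in> edges H"
    | (none) "\<And>a b. a \<in> A \<Longrightarrow> b \<in> A \<Longrightarrow> {a, b} \<notin> edges G \<and> {a, b} \<notin> edges H"
    by blast
  then show ?case
  proof cases
    case G
    then obtain x y where "twin_pair (\<lambda>u v. {u, v} \<in> edges G) (A \<inter> verts G) x y"
      using join.IH(1)[of "A \<inter> verts G" a b] inG by auto
    then have "twin_pair (\<lambda>u v. {u, v} \<in> edges (graph_join G H)) A x y"
      unfolding edge by (rule twin_pair_module) (use inG inH join.hyps(3) sub in blast)+
    then show ?thesis by blast
  next
    case H
    then obtain x y where "twin_pair (\<lambda>u v. {u, v} \<in> edges H) (A \<inter> verts H) x y"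
      using join.IH(2)[of "A \<inter> verts H" a b] inH by auto
    then have "twin_pair (\<lambda>u v. {u, v} \<in> edges (graph_join G H)) A x y"
      unfolding edge by (rule twin_pair_module) (use inG inH join.hyps(3) sub in blast)+
    then show ?thesis by blast
  next
    case none
    \<comment> \<open>\<open>A\<close> induces a complete bipartite graph between the two sides, so
      the private classes of an edge are the sides themselves.\<close>
    have adj: "{a, b} \<in> edges (graph_join G H) \<longleftrightarrow> (a \<in> verts G \<longleftrightarrow> b \<notin> verts G)" if "a \<in> A" "b \<in> A" for a b
      using none[OF that] sub that join.hyps(3) unfolding edge by blast
    have "twin_pair (\<lambda>u v. {u, v} \<in> edges (graph_join G H)) A u v"
      using join.prems adj unfolding twin_pair_def private_nbrs_def by auto
    then show ?thesis by blast
  qed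
qed

text \<open>If deleting \<open>uv\<close> raises \<open>alpha\<close>, a larger set \<open>T\<close>
  contains both ends, and \<open>S = T - {u, v}\<close> witnesses a critical edge. Conversely,
  \<open>S\<close> with both ends added becomes independent once \<open>uv\<close> is gone.\<close>

lemma alpha_stability_iff:
  assumes "simple_graph G"
  shows "G \<in> alpha_stability \<longleftrightarrow> marked_stable (\<lambda>u v. {u, v} \<in> edges G) (verts G) {}"
proof -
  let ?E = "\<lambda>u v. {u, v} \<in> edges G"
  have fin: "finite (verts G)" and edges: "\<And>e. e \<in> edges G \<Longrightarrow> e \<subseteq> verts G \<and> card e = 2"
    using assms unfolding simple_graph_def by auto
  have ind: "independent_set G S \<longleftrightarrow> indep ?E (verts G) S" for S
    unfolding independent_set_def indep_def ..
  have fins: "finite (card ` {S. independent_set H S})" "card ` {S. independent_set H S} \<noteq> {}"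
    if "verts H = verts G" for H :: "'a graph"
  proof -
    have "{S. independent_set H S} \<subseteq> Pow (verts G)" using that by (auto simp: independent_set_def)
    then show "finite (card ` {S. independent_set H S})" using fin by (meson finite_Pow_iff finite_imageI finite_subset)
    have "independent_set H {}" by (simp add: independent_set_def)
    then show "card ` {S. independent_set H S} \<noteq> {}" by auto
  qed
  have alpha_ge: "card S \<le> alpha H" if "independent_set H S" "verts H = verts G" for S and H :: "'a graph"
    unfolding alpha_def using that fins by (intro Max_ge) auto
  have alpha_ex: "\<exists>S. independent_set H S \<and> card S = alpha H" if "verts H = verts G" for H :: "'a graph"
    using Max_in[OF fins[OF that]] unfolding alpha_def by auto
  have max: "max_indep ?E (verts G) S \<longleftrightarrow> independent_set G S \<and> card S = alpha G" for S
    using alpha_ge[of G] alpha_ex[of G] unfolding max_indep_def ind[symmetric] by (metis le_antisym)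
  have del: "verts (delete_edge G e) = verts G" "edges (delete_edge G e) = edges G - {e}" for e
    by (auto simp: delete_edge_def)
  have finS: "finite S" if "independent_set H S" "verts H = verts G" for S and H :: "'a graph"
    using that fin by (auto simp: independent_set_def intro: finite_subset)
  have mono: "alpha G \<le> alpha (delete_edge G e)" for e
  proof -
    obtain S where S: "independent_set G S" "card S = alpha G" using alpha_ex[of G] by auto
    then have "independent_set (delete_edge G e) S" by (auto simp: independent_set_def del)
    then show ?thesis using alpha_ge[of "delete_edge G e" S] S del by auto
  qed
  have crit: "alpha (delete_edge G {u, v}) \<noteq> alpha G \<longleftrightarrow>
      (\<exists>S. u \<notin> S \<and> v \<notin> S \<and> max_indep ?E (verts G) (insert u S) \<and> max_indep ?E (verts G) (insert v S))"
    if uv: "{u, v} \<in> edges G" for u v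
  proof
    have neq: "u \<noteq> v" using edges[OF uv] by auto
    {
      assume "alpha (delete_edge G {u, v}) \<noteq> alpha G"
      then have gt: "alpha G < alpha (delete_edge G {u, v})" using mono[of "{u, v}"] by simp
      obtain T where T: "independent_set (delete_edge G {u, v}) T" "card T = alpha (delete_edge G {u, v})"
        using alpha_ex[of "delete_edge G {u, v}"] del by auto
      have finT: "finite T" using finS[OF T(1)] del by auto
      have "\<not> independent_set G T" using alpha_ge[of G T] T gt by auto
      then obtain a b where "a \<in> T" "b \<in> T" "{a, b} \<in> edges G" "{a, b} = {u, v}"
        using T(1) unfolding independent_set_def del by blast
      then have uvT: "u \<in> T" "v \<in> T" by (auto simp: doubleton_eq_iff)
      have iu: "independent_set G (T - {v})" and iv: "independent_set G (T - {u})"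
        using T(1) unfolding independent_set_def del by (auto simp: doubleton_eq_iff)
      \<comment> \<open>\<open>T\<close> has more than \<open>alpha G\<close> elements, but without
        one end it is independent in \<open>G\<close>; this forces both sizes.\<close>
      have "card (T - {v}) = alpha G" "card (T - {u}) = alpha G"
        using alpha_ge[OF iu] alpha_ge[OF iv] uvT finT gt T(2) by (auto simp: card_Diff_singleton)
      moreover have "insert u (T - {u, v}) = T - {v}" "insert v (T - {u, v}) = T - {u}"
        using uvT neq by auto
      ultimately show "\<exists>S. u \<notin> S \<and> v \<notin> S \<and> max_indep ?E (verts G) (insert u S) \<and> max_indep ?E (verts G) (insert v S)"
        using iu iv unfolding max by (intro exI[of _ "T - {u, v}"]) auto
    next
      assume "\<exists>S. u \<notin> S \<and> v \<notin> S \<and> max_indep ?E (verts G) (insert u S) \<and> max_indep ?E (verts G) (insert v S)"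
      then obtain S where S: "u \<notin> S" "v \<notin> S" "independent_set G (insert u S)" "card (insert u S) = alpha G"
          "independent_set G (insert v S)"
        unfolding max by blast
      have "finite S" using finS[OF S(3)] by auto
      then have "card (insert u (insert v S)) = alpha G + 1" using S neq by auto
      moreover have "independent_set (delete_edge G {u, v}) (insert u (insert v S))"
        using S(3,5) unfolding independent_set_def del by (auto simp: insert_commute)
      ultimately show "alpha (delete_edge G {u, v}) \<noteq> alpha G"
        using alpha_ge[of "delete_edge G {u, v}"] del by fastforce
    }
  qed
  have "(\<forall>e\<in>edges G. alpha (delete_edge G e) = alpha G) \<longleftrightarrow>
      (\<forall>u v. {u, v} \<in> edges G \<longrightarrow> alpha (delete_edge G {u, v}) = alpha G)"
  proof (intro iffI ballI allI impI)
    fix e assume all: "\<forall>u v. {u, v} \<in> edges G \<longrightarrow> alpha (delete_edge G {u, v}) = alpha G" and e: "e \<in> edges G"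
    then obtain u v where "e = {u, v}" using edges[OF e] by (auto simp: card_2_iff)
    then show "alpha (delete_edge G e) = alpha G" using all e by simp
  qed simp
  also have "\<dots> \<longleftrightarrow> marked_stable ?E (verts G) {}"
  proof -
    have "alpha (delete_edge G {u, v}) = alpha G \<longleftrightarrow> (\<forall>S. u \<notin> S \<longrightarrow> v \<notin> S \<longrightarrow>
        max_indep ?E (verts G) (insert u S) \<longrightarrow> \<not> max_indep ?E (verts G) (insert v S))"
      if "{u, v} \<in> edges G" for u v
      using crit[OF that] by blast
    then show ?thesis by (auto simp: marked_stable_def)
  qed
  finally show ?thesis
    using assms by (simp add: alpha_stability_def)
qed

section \<open>The decision procedure\<close>

abbreviation alive :: "nat \<Rightarrow> fm" where
  "alive v \<equiv> Neg (Mark v 2)"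

definition priv_fm :: "nat \<Rightarrow> nat \<Rightarrow> fm" where
  "priv_fm x y = Conj (alive 6) (Conj (Adj 6 y) (Neg (Adj 6 x)))"

text \<open>The inner conjunction is an exclusive or: no present vertex 7 distinguishes a private
  neighbour 6 from \<open>x\<close>.\<close>

definition twins_fm :: "nat \<Rightarrow> nat \<Rightarrow> fm" where
  "twins_fm x y = Neg (Ex 6 (Conj (priv_fm x y) (Ex 7 (Conj (alive 7)
     (Conj (Neg (Conj (Adj 6 7) (Adj x 7))) (Neg (Conj (Neg (Adj 6 7)) (Neg (Adj x 7)))))))))"

text \<open>Variables 4 and 5 are \<open>x\<close> and \<open>y\<close>, 6 and 7 are bound, 8 is the
  counter. The comparison selects the orientation in which the class to be deleted is the smaller
  one.\<close>

definition pair_fm :: fm where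
  "pair_fm = Conj (alive 4) (Conj (alive 5) (Conj (Adj 4 5) (Conj (twins_fm 4 5) (Conj (twins_fm 5 4)
     (Le 8 6 0 (priv_fm 4 5) (priv_fm 5 4))))))"

text \<open>\<open>Adj 6 6\<close> is false, so that the second comparison expresses \<open>card \<le> 1\<close>.\<close>

definition new_mark_fm :: fm where
  "new_mark_fm = Conj (Le 8 6 0 (priv_fm 5 4) (priv_fm 4 5))
     (Neg (Conj (Neg (Le 8 6 1 (priv_fm 4 5) (Adj 6 6))) (Neg (Ex 6 (Conj (priv_fm 4 5) (Mark 6 3))))))"

text \<open>The mark comes before the deletion, because \<open>new_mark_fm\<close> has to see the
  class while it is still present.\<close>

definition reduce :: cmd where
  "reduce = When pair_fm (Sq (When new_mark_fm (Set 5 3)) (For 6 (When (priv_fm 4 5) (Set 6 2))))"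

text \<open>Variable 9 only counts rounds. Each round tries all ordered pairs, and \<open>n\<close>
  rounds are enough since each round with a deletion removes a vertex.\<close>

definition reduce_all :: cmd where
  "reduce_all = For 9 (For 4 (For 5 reduce))"

text \<open>Marks: 1 for a vertex that is present, 2 for a deleted one, 3 for one that is present and marked.\<close>

definition live :: "nat \<Rightarrow> (nat \<Rightarrow> nat) \<Rightarrow> nat set" where
  "live n m = {i. i < n \<and> m i \<noteq> 2}"

definition marked :: "nat \<Rightarrow> (nat \<Rightarrow> nat) \<Rightarrow> nat set" where
  "marked n m = {i. i < n \<and> m i = 3}"

lemma finite_live: "finite (live n m)"
  by (simp add: live_def)

lemma sat_priv_fm:
  assumes "x \<noteq> 6" "y \<noteq> 6" "i < n"
  shows "sat n E m (\<sigma>(6 := i)) (priv_fm x y) \<longleftrightarrow> i \<in> private_nbrs E (live n m) (\<sigma> x) (\<sigma> y)"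
  using assms by (auto simp: priv_fm_def private_nbrs_def live_def)

lemma card_priv_fm:
  assumes "x \<noteq> 6" "y \<noteq> 6"
  shows "card {i. i < n \<and> sat n E m (\<sigma>(6 := i)) (priv_fm x y)} = card (private_nbrs E (live n m) (\<sigma> x) (\<sigma> y))"
proof -
  have "{i. i < n \<and> sat n E m (\<sigma>(6 := i)) (priv_fm x y)} = private_nbrs E (live n m) (\<sigma> x) (\<sigma> y)"
    using sat_priv_fm[OF assms] by (auto simp: private_nbrs_def live_def)
  then show ?thesis by simp
qed

lemma sat_twins_fm:
  assumes "x \<noteq> 6" "y \<noteq> 6" "x \<noteq> 7" "y \<noteq> 7"
  shows "sat n E m \<sigma> (twins_fm x y) \<longleftrightarrow>
    (\<forall>k\<in>private_nbrs E (live n m) (\<sigma> x) (\<sigma> y). \<forall>l\<in>live n m. E k l = E (\<sigma> x) l)"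
proof -
  have "sat n E m \<sigma> (twins_fm x y) \<longleftrightarrow> (\<forall>i<n. sat n E m (\<sigma>(6 := i)) (priv_fm x y) \<longrightarrow>
      (\<forall>l<n. m l \<noteq> 2 \<longrightarrow> E i l = E (\<sigma> x) l))"
    using assms by (auto simp: twins_fm_def)
  also have "\<dots> \<longleftrightarrow> (\<forall>k\<in>private_nbrs E (live n m) (\<sigma> x) (\<sigma> y). \<forall>l\<in>live n m. E k l = E (\<sigma> x) l)"
    using sat_priv_fm[OF assms(1,2), of _ n E m \<sigma>] by (auto simp: live_def private_nbrs_def)
  finally show ?thesis .
qed

lemma sat_pair_fm:
  assumes "\<sigma> 4 < n" "\<sigma> 5 < n"
  shows "sat n E m \<sigma> pair_fm \<longleftrightarrow> twin_pair E (live n m) (\<sigma> 4) (\<sigma> 5) \<and>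
    card (private_nbrs E (live n m) (\<sigma> 4) (\<sigma> 5)) \<le> card (private_nbrs E (live n m) (\<sigma> 5) (\<sigma> 4))"
  using assms by (auto simp: pair_fm_def sat_twins_fm card_priv_fm twin_pair_def live_def simp del: fun_upd_apply)

lemma sat_new_mark_fm:
  assumes "\<And>u. \<not> E u u"
  shows "sat n E m \<sigma> new_mark_fm \<longleftrightarrow> new_mark E (live n m) (marked n m) (\<sigma> 4) (\<sigma> 5)"
proof -
  have "(\<exists>i<n. sat n E m (\<sigma>(6 := i)) (priv_fm 4 5) \<and> m i = 3) \<longleftrightarrow>
      private_nbrs E (live n m) (\<sigma> 4) (\<sigma> 5) \<inter> marked n m \<noteq> {}"
    using sat_priv_fm[of 4 5 _ n E m \<sigma>] by (auto simp: marked_def)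
  then show ?thesis
    using assms by (auto simp: new_mark_fm_def new_mark_def card_priv_fm)
qed

text \<open>The loop tests the formula on marks that it is changing. This is harmless: whether
  \<open>j\<close> is deleted depends only on the mark of \<open>j\<close> itself and on
  adjacencies, so earlier deletions, even that of \<open>x\<close>, do not matter.\<close>

lemma exec_delete:
  "exec n E (For 6 (When (priv_fm 4 5) (Set 6 2))) \<sigma> m =
     (\<lambda>i. if i \<in> private_nbrs E (live n m) (\<sigma> 4) (\<sigma> 5) then 2 else m i)"
proof -
  let ?f = "\<lambda>i. exec n E (When (priv_fm 4 5) (Set 6 2)) (\<sigma>(6 := i))"
  let ?X = "private_nbrs E (live n m) (\<sigma> 4) (\<sigma> 5)"
  have "fold ?f [0..<j] m = (\<lambda>i. if i < j \<and> i \<in> ?X then 2 else m i)" if "j \<le> n" for j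
    using that
  proof (induction j)
    case (Suc j)
    let ?m = "\<lambda>i. if i < j \<and> i \<in> ?X then 2 else m i"
    have "j \<in> private_nbrs E (live n ?m) (\<sigma> 4) (\<sigma> 5) \<longleftrightarrow> j \<in> ?X"
      using Suc.prems by (auto simp: private_nbrs_def live_def)
    then have "?f j ?m = (\<lambda>i. if i < Suc j \<and> i \<in> ?X then 2 else m i)"
      using sat_priv_fm[of 4 5 j n E ?m \<sigma>] Suc.prems by (auto simp: fun_eq_iff less_Suc_eq)
    moreover have "fold ?f [0..<Suc j] m = ?f j (fold ?f [0..<j] m)"
      by (simp del: exec.simps)
    ultimately show ?case using Suc by (simp del: exec.simps fun_upd_apply)
  qed simp
  from this[of n] show ?thesis
    by (auto simp: fun_eq_iff private_nbrs_def live_def)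
qed

lemma exec_reduce:
  fixes m \<sigma> :: "nat \<Rightarrow> nat"
  assumes "irreflexive_graph E" "\<sigma> 4 < n" "\<sigma> 5 < n"
  defines "m' \<equiv> exec n E reduce \<sigma> m"
  defines "fires \<equiv> twin_pair E (live n m) (\<sigma> 4) (\<sigma> 5) \<and>
    card (private_nbrs E (live n m) (\<sigma> 4) (\<sigma> 5)) \<le> card (private_nbrs E (live n m) (\<sigma> 5) (\<sigma> 4))"
  shows "\<not> fires \<Longrightarrow> m' = m"
    and "fires \<Longrightarrow> card (live n m') < card (live n m)"
    and "marked_stable E (live n m') (marked n m') \<longleftrightarrow> marked_stable E (live n m) (marked n m)"
proof -
  interpret irreflexive_graph E by fact
  let ?X = "private_nbrs E (live n m) (\<sigma> 4) (\<sigma> 5)"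
  have fires: "sat n E m \<sigma> pair_fm \<longleftrightarrow> fires"
    unfolding fires_def using sat_pair_fm[of \<sigma> n E m] assms(2,3) by blast
  show no: "m' = m" if "\<not> fires"
    using that fires by (simp add: m'_def reduce_def)
  let ?m = "if new_mark E (live n m) (marked n m) (\<sigma> 4) (\<sigma> 5) then m(\<sigma> 5 := 3) else m"
  have *: "live n m' = live n m - ?X \<and>
      marked n m' = (if new_mark E (live n m) (marked n m) (\<sigma> 4) (\<sigma> 5) then insert (\<sigma> 5) (marked n m) else marked n m) - ?X"
    if fires
  proof -
    have y: "\<sigma> 5 \<in> live n m" using that unfolding fires_def twin_pair_def by blast
    \<comment> \<open>\<open>y\<close> is present, so giving it mark 3 revives no deleted
      vertex.\<close>
    then have live: "live n ?m = live n m" by (auto simp: live_def)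
    have "m' = exec n E (For 6 (When (priv_fm 4 5) (Set 6 2))) \<sigma> ?m"
      using that fires sat_new_mark_fm[of E n m \<sigma>] irrefl by (simp add: m'_def reduce_def)
    then have m': "m' = (\<lambda>i. if i \<in> ?X then 2 else ?m i)"
      unfolding exec_delete live .
    have "live n m' = live n ?m - ?X"
      unfolding m' by (auto simp: live_def)
    moreover have "marked n m' = marked n ?m - ?X"
      unfolding m' by (auto simp: marked_def)
    moreover have "marked n ?m = (if new_mark E (live n m) (marked n m) (\<sigma> 4) (\<sigma> 5)
        then insert (\<sigma> 5) (marked n m) else marked n m)"
      using assms(3) by (auto simp: marked_def)
    ultimately show ?thesis unfolding live by simp
  qed
  show "card (live n m') < card (live n m)" if f: fires
  proof -
    have "\<sigma> 4 \<in> ?X"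
      using f irrefl[of "\<sigma> 4"] unfolding fires_def twin_pair_def private_nbrs_def by blast
    moreover have "?X \<subseteq> live n m" by (auto simp: private_nbrs_def)
    ultimately have "live n m - ?X \<subset> live n m" by blast
    then show ?thesis using *[OF f] finite_live by (metis psubset_card_mono)
  qed
  show "marked_stable E (live n m') (marked n m') \<longleftrightarrow> marked_stable E (live n m) (marked n m)"
  proof (cases fires)
    case True
    then show ?thesis
      using marked_stable_delete[OF finite_live, of n m "\<sigma> 4" "\<sigma> 5" "marked n m"] *[OF True]
      unfolding fires_def by simp
  qed (simp add: no)
qed

text \<open>Either the measure drops, or every step was idle, so that all the \<open>P i\<close>
  hold of one and the same state. Stated for a general fold, it serves first for a row of pairs and
  then for a whole round.\<close>

lemma fold_decreasing:
  fixes \<mu> :: "'b \<Rightarrow> nat"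
  assumes "\<And>i m. i \<in> set xs \<Longrightarrow> I m \<Longrightarrow> I (f i m) \<and> (f i m = m \<and> P i m \<or> \<mu> (f i m) < \<mu> m)"
    and "I m"
  shows "I (fold f xs m) \<and> (fold f xs m = m \<and> (\<forall>i\<in>set xs. P i m) \<or> \<mu> (fold f xs m) < \<mu> m)"
  using assms
proof (induction xs arbitrary: m)
  case (Cons i xs)
  have 1: "I (f i m)" "f i m = m \<and> P i m \<or> \<mu> (f i m) < \<mu> m" using Cons.prems by auto
  have "I (fold f xs (f i m)) \<and> (fold f xs (f i m) = f i m \<and> (\<forall>j\<in>set xs. P j (f i m)) \<or>
      \<mu> (fold f xs (f i m)) < \<mu> (f i m))"
    using Cons.IH[OF _ 1(1)] Cons.prems(1) by auto
  then show ?case using 1(2) by auto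
qed simp

lemma fold_fixed: "(\<And>i. i \<in> set xs \<Longrightarrow> f i m = m) \<Longrightarrow> fold f xs m = m"
  by (induction xs) auto

lemma exec_reduce_all:
  assumes E: "irreflexive_graph E"
    and pairs: "\<And>A u v. A \<subseteq> {..<n} \<Longrightarrow> u \<in> A \<Longrightarrow> v \<in> A \<Longrightarrow> E u v \<Longrightarrow> \<exists>x y. twin_pair E A x y"
  shows "marked_stable E {..<n} {} \<longleftrightarrow> marked n (exec n E reduce_all \<sigma> (\<lambda>_. 1)) = {}"
proof -
  interpret irreflexive_graph E by fact
  let ?I = "\<lambda>m. marked_stable E (live n m) (marked n m) \<longleftrightarrow> marked_stable E {..<n} {}"
  let ?fires = "\<lambda>m x y. twin_pair E (live n m) x y \<and>
    card (private_nbrs E (live n m) x y) \<le> card (private_nbrs E (live n m) y x)"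
  let ?\<sigma> = "\<lambda>i x y. \<sigma>(9 := i, 4 := x, 5 := y)"
  let ?row = "\<lambda>i x. exec n E (For 5 reduce) (\<sigma>(9 := i, 4 := x))"
  let ?round = "\<lambda>i. exec n E (For 4 (For 5 reduce)) (\<sigma>(9 := i))"
  let ?\<mu> = "\<lambda>m. card (live n m)"
  have step: "?I (exec n E reduce (?\<sigma> i x y) m) \<and> (exec n E reduce (?\<sigma> i x y) m = m \<and> \<not> ?fires m x y \<or>
      ?\<mu> (exec n E reduce (?\<sigma> i x y) m) < ?\<mu> m)" if "x < n" "y < n" "?I m" for i x y m
    using exec_reduce[OF E, of "?\<sigma> i x y" n m] that by auto
  have row: "?I (?row i x m) \<and> (?row i x m = m \<and> (\<forall>y<n. \<not> ?fires m x y) \<or> ?\<mu> (?row i x m) < ?\<mu> m)"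
    if "x < n" "?I m" for i x m
    using fold_decreasing[of "[0..<n]" ?I "\<lambda>y. exec n E reduce (?\<sigma> i x y)" "\<lambda>y m. \<not> ?fires m x y" ?\<mu> m]
      step that by auto
  have round: "?I (?round i m) \<and> (?round i m = m \<and> (\<forall>x<n. \<forall>y<n. \<not> ?fires m x y) \<or> ?\<mu> (?round i m) < ?\<mu> m)"
    if "?I m" for i m
    using fold_decreasing[of "[0..<n]" ?I "?row i" "\<lambda>x m. \<forall>y<n. \<not> ?fires m x y" ?\<mu> m] row that by auto
  have fixed: "?round i m = m" if none: "\<forall>x<n. \<forall>y<n. \<not> ?fires m x y" for i m
  proof -
    have "exec n E reduce (?\<sigma> i x y) m = m" if "x < n" "y < n" for x y
      using exec_reduce(1)[OF E, of "?\<sigma> i x y" n m] none that by auto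
    then have "?row i x m = m" if "x < n" for x
      using that by (auto intro: fold_fixed)
    then show ?thesis by (auto intro!: fold_fixed simp del: exec.simps simp add: exec.simps(4)[of n E 4])
  qed
  have live0: "live n (\<lambda>_. 1) = {..<n}" and marked0: "marked n (\<lambda>_. 1) = {}"
    by (auto simp: live_def marked_def)
  define M where "M j = fold ?round [0..<j] (\<lambda>_. 1)" for j
  have M_Suc: "M (Suc j) = ?round j (M j)" for j
    by (simp add: M_def del: exec.simps)
  \<comment> \<open>Until no pair is left, every round removes at least one of the \<open>n\<close>
    vertices.\<close>
  have "?I (M j) \<and> (?\<mu> (M j) + j \<le> n \<or> (\<forall>x<n. \<forall>y<n. \<not> ?fires (M j) x y))" for j
  proof (induction j)
    case 0
    have "M 0 = (\<lambda>_. 1)" by (simp add: M_def)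
    then show ?case by (simp only: live0 marked0) simp
  next
    case (Suc j)
    then have I: "?I (M (Suc j))" using round[of "M j" j] unfolding M_Suc by blast
    show ?case
    proof (cases "\<forall>x<n. \<forall>y<n. \<not> ?fires (M j) x y")
      case True
      then have "M (Suc j) = M j" using fixed[OF True] unfolding M_Suc by blast
      then show ?thesis using I True by simp
    next
      case False
      then have "?\<mu> (M (Suc j)) < ?\<mu> (M j)" using round[of "M j" j] Suc unfolding M_Suc by blast
      moreover have "?\<mu> (M j) + j \<le> n" using Suc False by blast
      ultimately show ?thesis using I by linarith
    qed
  qed
  from this[of n] have I: "?I (M n)" and "?\<mu> (M n) = 0 \<or> (\<forall>x<n. \<forall>y<n. \<not> ?fires (M n) x y)"
    by auto
  \<comment> \<open>If no vertex is left, there is no pair either.\<close>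
  then have none: "\<forall>x<n. \<forall>y<n. \<not> ?fires (M n) x y"
    using finite_live by (auto simp: twin_pair_def)
  have edgeless: "\<not> E u v" if uv: "u \<in> live n (M n)" "v \<in> live n (M n)" for u v
  proof
    assume "E u v"
    then obtain x y where xy: "twin_pair E (live n (M n)) x y"
      using pairs[OF _ uv] by (auto simp: live_def)
    then have "x < n" "y < n" by (auto simp: twin_pair_def live_def)
    \<comment> \<open>One of the two orientations of the pair has the smaller class first and would
      fire.\<close>
    then show False
      using none xy twin_pair_sym[OF xy] by (meson nat_le_linear)
  qed
  have "marked n (M n) \<subseteq> live n (M n)"
    by (auto simp: marked_def live_def)
  then show ?thesis
    using I marked_stable_edgeless[OF finite_live edgeless] by (auto simp: reduce_all_def M_def)
qed

section \<open>Vertices as indices\<close>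

text \<open>The machine sees vertices only as positions in the enumeration; this carries stability
  over to the numbering.\<close>

lemma marked_stable_image:
  assumes inj: "inj_on f A"
  shows "marked_stable E (f ` A) {} \<longleftrightarrow> marked_stable (\<lambda>i j. E (f i) (f j)) A {}"
proof -
  let ?E = "\<lambda>i j. E (f i) (f j)"
  have ind: "indep E (f ` A) (f ` S) \<longleftrightarrow> indep ?E A S" if "S \<subseteq> A" for S
    using that by (auto simp: indep_def)
  have card: "card (f ` S) = card S" if "S \<subseteq> A" for S
    using inj that by (metis card_image inj_on_subset)
  have sub: "S \<subseteq> A" if "indep ?E A S" for S using that by (simp add: indep_def)
  have max: "max_indep E (f ` A) (f ` S) \<longleftrightarrow> max_indep ?E A S" if S: "S \<subseteq> A" for S
  proof
    assume max: "max_indep E (f ` A) (f ` S)"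
    have "card T \<le> card S" if "indep ?E A T" for T
      using max ind[OF sub[OF that]] card[OF sub[OF that]] card[OF S] that by (auto simp: max_indep_def)
    then show "max_indep ?E A S" using max ind[OF S] by (simp add: max_indep_def)
  next
    assume max: "max_indep ?E A S"
    have "card T \<le> card (f ` S)" if T: "indep E (f ` A) T" for T
    proof -
      obtain T' where T': "T' \<subseteq> A" "T = f ` T'" using T by (auto simp: indep_def subset_image_iff)
      then show ?thesis using max ind[OF T'(1)] card[OF T'(1)] card[OF S] T by (simp add: max_indep_def)
    qed
    then show "max_indep E (f ` A) (f ` S)" using max ind[OF S] by (simp add: max_indep_def)
  qed
  show ?thesis
  proof
    assume st: "marked_stable E (f ` A) {}"
    show "marked_stable ?E A {}"
      unfolding marked_stable_def
    proof (intro conjI allI impI notI)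
      fix u v S assume *: "E (f u) (f v)" "u \<notin> S" "v \<notin> S" "max_indep ?E A (insert u S)" "max_indep ?E A (insert v S)"
      then have A: "insert u S \<subseteq> A" "insert v S \<subseteq> A" by (auto simp: max_indep_def indep_def)
      then have "f u \<notin> f ` S" "f v \<notin> f ` S" using inj *(2,3) by (auto dest: inj_onD)
      moreover have "max_indep E (f ` A) (insert (f u) (f ` S))" "max_indep E (f ` A) (insert (f v) (f ` S))"
        using * max[OF A(1)] max[OF A(2)] by auto
      ultimately show False using st *(1) unfolding marked_stable_def by blast
    qed simp
  next
    assume st: "marked_stable ?E A {}"
    show "marked_stable E (f ` A) {}"
      unfolding marked_stable_def
    proof (intro conjI allI impI notI)
      fix u v S
      assume *: "E u v" "u \<notin> S" "v \<notin> S" "max_indep E (f ` A) (insert u S)" "max_indep E (f ` A) (insert v S)"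
      then have "u \<in> f ` A" "v \<in> f ` A" "S \<subseteq> f ` A" by (auto simp: max_indep_def indep_def)
      then obtain u' v' S' where A: "u' \<in> A" "v' \<in> A" "S' \<subseteq> A" "u = f u'" "v = f v'" "S = f ` S'"
        by (auto simp: subset_image_iff)
      then have "max_indep ?E A (insert u' S')" "max_indep ?E A (insert v' S')"
        using * max[of "insert u' S'"] max[of "insert v' S'"] by auto
      moreover have "u' \<notin> S'" "v' \<notin> S'" using * A by auto
      ultimately show False using st *(1) A(4,5) unfolding marked_stable_def by blast
    qed simp
  qed
qed

lemma twin_pair_image:
  assumes "twin_pair E (f ` A) (f i) (f j)" "i \<in> A" "j \<in> A"
  shows "twin_pair (\<lambda>a b. E (f a) (f b)) A i j"
proof -
  have priv: "f k \<in> private_nbrs E (f ` A) (f a) (f b)" if "k \<in> private_nbrs (\<lambda>a b. E (f a) (f b)) A a b" for k a b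
    using that by (simp add: private_nbrs_def)
  have X: "E (f k) (f l) = E (f i) (f l)" if "k \<in> private_nbrs (\<lambda>a b. E (f a) (f b)) A i j" "l \<in> A" for k l
    using assms(1) priv[OF that(1)] imageI[OF that(2), of f] unfolding twin_pair_def by blast
  have Y: "E (f k) (f l) = E (f j) (f l)" if "k \<in> private_nbrs (\<lambda>a b. E (f a) (f b)) A j i" "l \<in> A" for k l
    using assms(1) priv[OF that(1)] imageI[OF that(2), of f] unfolding twin_pair_def by blast
  have "E (f i) (f j)" using assms(1) unfolding twin_pair_def by blast
  then show ?thesis
    unfolding twin_pair_def using assms(2,3) X Y by (intro conjI ballI)
qed

lemma nth_concat_uniform:
  assumes "\<And>r. r \<in> set rows \<Longrightarrow> length r = l" "i < length rows" "j < l"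
  shows "concat rows ! (i * l + j) = rows ! i ! j"
  using assms
proof (induction rows arbitrary: i)
  case (Cons r rows)
  then show ?case by (cases i) (auto simp: nth_append add.assoc)
qed simp

lemma length_adjacency_matrix: "length (adjacency_matrix G xs) = length xs * Suc (length xs)"
  by (simp add: adjacency_matrix_def length_concat comp_def sum_list_triv)

lemma input_tape_adjacency_matrix:
  "input_tape (adjacency_matrix G xs) =
     matrix_tape (length xs) (\<lambda>i j. {xs ! i, xs ! j} \<in> edges G) 0"
proof -
  let ?n = "length xs" and ?E = "\<lambda>i j. {xs ! i, xs ! j} \<in> edges G"
  have "symbol_of (adjacency_matrix G xs ! p) = matrix ?n ?E p" if p: "p < ?n * Suc ?n" for p
  proof -
    define i j where "i = p div Suc ?n" and "j = p mod Suc ?n"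
    have ij: "p = i * Suc ?n + j" "i < ?n" "j < Suc ?n"
      using p unfolding i_def j_def by (auto intro: less_mult_imp_div_less simp only: div_mult_mod_eq mod_less_divisor)
    have "adjacency_matrix G xs ! p =
        (map (\<lambda>v. if {xs ! i, v} \<in> edges G then One else Zero) xs @ [Sep]) ! j"
      unfolding ij(1) adjacency_matrix_def using ij(2,3)
      by (subst nth_concat_uniform) auto
    then show ?thesis
      unfolding matrix_def i_def[symmetric] j_def[symmetric] using ij(2,3) by (auto simp: nth_append)
  qed
  then show ?thesis
    unfolding input_tape_def tp_def length_adjacency_matrix
    by (auto simp: fun_eq_iff nat_less_iff simp del: mult_Suc_right)
qed

section \<open>Initialization and the final machine\<close>

fun fill :: "nat \<Rightarrow> com" where
  "fill 0 = skip"
| "fill (Suc j) = Put (Suc j) 1 ;; Go (Suc j) Right ;; fill j"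

fun rewinds :: "nat \<Rightarrow> com" where
  "rewinds 0 = skip"
| "rewinds (Suc j) = rewind j ;; rewinds j"

text \<open>The number of vertices is the length of the first row: each of its cells adds a 1 to
  every other tape. This yields the unary tapes and also the initial marks, as 1 means
  present.\<close>

definition initialize :: "nat \<Rightarrow> com" where
  "initialize k = Until 0 3 (Go 0 Right ;; fill (k - 1)) ;; rewinds k"

lemma valid_fill: "j < k \<Longrightarrow> 2 < k \<Longrightarrow> valid k (fill j)"
  by (induction j) auto

lemma valid_rewinds: "j \<le> k \<Longrightarrow> 2 < k \<Longrightarrow> valid k (rewinds j)"
  by (induction j) (auto simp: rewind_def)

lemma wp_fill:
  assumes "Q (\<lambda>i. if 1 \<le> i \<and> i \<le> j then go Right (put 1 (\<tau> i)) else \<tau> i)"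
  shows "wp (fill j) (4 * j + 1) Q \<tau>"
  using assms
proof (induction j arbitrary: \<tau>)
  case 0
  have "(\<lambda>i. if 1 \<le> i \<and> i \<le> 0 then go Right (put 1 (\<tau> i)) else \<tau> i) = \<tau>" by auto
  then show ?case using 0 by (simp add: wp_skip[unfolded One_nat_def])
next
  case (Suc j)
  let ?\<tau> = "\<tau>(Suc j := put 1 (\<tau> (Suc j)), Suc j := go Right ((\<tau>(Suc j := put 1 (\<tau> (Suc j)))) (Suc j)))"
  have "(\<lambda>i. if 1 \<le> i \<and> i \<le> j then go Right (put 1 (?\<tau> i)) else ?\<tau> i) =
      (\<lambda>i. if 1 \<le> i \<and> i \<le> Suc j then go Right (put 1 (\<tau> i)) else \<tau> i)"
    by (auto simp: fun_eq_iff le_Suc_eq)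
  then have "wp (fill j) (4 * j + 1) Q ?\<tau>" by (intro Suc.IH) (simp only: Suc.prems)
  then have "wp (fill (Suc j)) (1 + (1 + (4 * j + 1) + 1) + 1) Q \<tau>"
    unfolding fill.simps by (intro wp_Seq wp_Put wp_Go)
  then show ?case by (rule wp_mono) auto
qed

lemma wp_rewinds:
  assumes "\<And>i. i < j \<Longrightarrow> \<exists>l u h. \<tau> i = tp l u (int h) \<and> h \<le> l \<and> l \<le> N \<and> (\<forall>p<l. u p \<noteq> 0)"
    and "Q (\<lambda>i. if i < j then (fst (\<tau> i), 0) else \<tau> i)"
  shows "wp (rewinds j) ((2 * N + 7) * j + 1) Q \<tau>"
  using assms
proof (induction j arbitrary: \<tau>)
  case 0
  then show ?case by (simp add: wp_skip[unfolded One_nat_def])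
next
  case (Suc j)
  obtain l u h where t: "\<tau> j = tp l u (int h)" "h \<le> l" "l \<le> N" "\<forall>p<l. u p \<noteq> 0" using Suc.prems(1)[of j] by auto
  let ?\<tau> = "\<tau>(j := tp l u 0)"
  have "(\<lambda>i. if i < j then (fst (?\<tau> i), 0) else ?\<tau> i) = (\<lambda>i. if i < Suc j then (fst (\<tau> i), 0) else \<tau> i)"
    using t(1) by (auto simp: fun_eq_iff tp_def less_Suc_eq)
  then have "wp (rewinds j) ((2 * N + 7) * j + 1) Q ?\<tau>"
    using Suc.prems by (intro Suc.IH) (simp_all del: fun_upd_apply add: fun_upd_other)
  then have "wp (rewinds (Suc j)) ((2 * l + 6) + ((2 * N + 7) * j + 1) + 1) Q \<tau>"
    unfolding rewinds.simps by (intro wp_Seq wp_rewind[where \<tau> = \<tau> and i = j, OF t(1,2)]) (use t(4) in simp_all)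
  then show ?case by (rule wp_mono) (use t(3) in auto)
qed

lemma wp_initialize:
  assumes w: "input_tape w = matrix_tape n E 0" and n: "0 < n" and k: "4 \<le> k"
  shows "wp (initialize k) (n * (4 * k) + (2 * (n * Suc n) + 7) * k + 3)
    (represents k n E {} \<sigma> (\<lambda>_. 1)) (initial_mem w)"
proof -
  let ?I = "\<lambda>j \<tau>. \<tau> 0 = matrix_tape n E (int j) \<and> (\<forall>i\<in>{1..<k}. \<tau> i = unary j (int j))"
  have k1: "1 + (4 * (k - 1) + 1) + 1 = 4 * k - 1" using k by simp
  have "wp (initialize k) ((n * ((1 + (4 * (k - 1) + 1) + 1) + 1) + 1) + ((2 * (n * Suc n) + 7) * k + 1) + 1)
      (represents k n E {} \<sigma> (\<lambda>_. 1)) (initial_mem w)"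
    unfolding initialize_def
  proof (rule wp_Seq, rule wp_Until[where I = ?I])
    have "blank_tape = unary 0 0" by (auto simp: blank_tape_def tp_def fun_eq_iff)
    then show "?I 0 (initial_mem w)" using w by (simp add: initial_mem_def)
  next
    fix j \<tau> assume j: "j < n" and I: "?I j \<tau>"
    have "j < n * Suc n" using entry_less[of 0 n j] j by simp
    then have "scan (\<tau> 0) \<noteq> 3"
      using I matrix_entry[OF j, of E 0] by simp
    moreover have grow: "go Right (put 1 (unary j (int j))) = unary (Suc j) (int (Suc j))"
      by (auto simp: tp_def fun_eq_iff)
    have "wp (Go 0 Right ;; fill (k - 1)) (1 + (4 * (k - 1) + 1) + 1) (?I (Suc j)) \<tau>"
    proof (rule wp_Seq, rule wp_Go, rule wp_fill)
      show "?I (Suc j) (\<lambda>i. if 1 \<le> i \<and> i \<le> k - 1 then go Right (put 1 ((\<tau>(0 := go Right (\<tau> 0))) i))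
          else (\<tau>(0 := go Right (\<tau> 0))) i)"
        using I grow k by (intro conjI ballI) (simp_all add: add.commute Suc_leI le_diff_conv2)
    qed
    ultimately show "scan (\<tau> 0) \<noteq> 3 \<and> wp (Go 0 Right ;; fill (k - 1)) (1 + (4 * (k - 1) + 1) + 1) (?I (Suc j)) \<tau>"
      by blast
  next
    fix \<tau> assume I: "?I n \<tau>"
    have less: "n < n * Suc n" using entry_less[of 0 n n] n by simp
    have "scan (\<tau> 0) = 3"
      using I less matrix_sep[of n E 0] by simp
    moreover have "wp (rewinds k) ((2 * (n * Suc n) + 7) * k + 1) (represents k n E {} \<sigma> (\<lambda>_. 1)) \<tau>"
    proof (rule wp_rewinds)
      fix i assume "i < k"
      show "\<exists>l u h. \<tau> i = tp l u (int h) \<and> h \<le> l \<and> l \<le> n * Suc n \<and> (\<forall>p<l. u p \<noteq> 0)"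
      proof (cases "i = 0")
        case True
        then show ?thesis
          using I less by (intro exI[of _ "n * Suc n"] exI[of _ "matrix n E"] exI[of _ n]) (simp add: matrix_def)
      next
        case False
        then have "\<tau> i = unary n (int n)" using I \<open>i < k\<close> by simp
        then show ?thesis
          using less by (intro exI[of _ n] exI[of _ "\<lambda>_. 1"]) auto
      qed
    next
      have fst: "(fst (tp l u h), 0) = tp l u 0" for l u h by (simp add: tp_def)
      let ?\<tau> = "\<lambda>i. if i < k then (fst (\<tau> i), 0) else \<tau> i"
      have "?\<tau> 0 = matrix_tape n E 0" using I k by (simp add: fst)
      moreover have unary: "?\<tau> i = unary n (int 0)" if "i \<in> {1..<k}" for i
        using I that by (simp add: fst)
      moreover have "\<exists>h\<le>n. ?\<tau> v = unary n (int h) \<and> (v \<in> {} \<longrightarrow> h = \<sigma> v)" if "v \<in> {4..<k}" for v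
        using unary[of v] that by (intro exI[of _ 0]) simp
      ultimately show "represents k n E {} \<sigma> (\<lambda>_. 1) ?\<tau>"
        unfolding represents_def using k unary[of 1] unary[of 3] by simp
    qed
    ultimately show "scan (\<tau> 0) = 3 \<and> wp (rewinds k) ((2 * (n * Suc n) + 7) * k + 1)
        (represents k n E {} \<sigma> (\<lambda>_. 1)) \<tau>"
      by blast
  qed
  then show ?thesis
    unfolding k1 by (rule wp_mono) (use k in auto)
qed

text \<open>Costs are polynomials in the number of vertices, while the final bound is evaluated at
  the length of the word, which is at least as large.\<close>

lemma poly_nat_mono: "x \<le> y \<Longrightarrow> poly p x \<le> poly (p :: nat poly) y"
  by (induction p) (auto intro: add_mono mult_mono)

text \<open>Guarantees a separator in the input; on the empty word \<open>initialize\<close> would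
  search for one forever.\<close>

lemma cograph_verts_nonempty: "cograph G \<Longrightarrow> verts G \<noteq> {}"
  by (induction rule: cograph.induct) (auto simp: graph_union_def graph_join_def)

definition unmarked_fm :: fm where
  "unmarked_fm = Neg (Ex 4 (Mark 4 3))"

text \<open>Ten tapes: four service tapes and the variables 4 to 9.\<close>

definition stability_code :: com where
  "stability_code = initialize 10 ;; code_cmd reduce_all ;; code unmarked_fm"

text \<open>With \<open>L = length w\<close> and \<open>n <= L\<close>, initialization takes at most
  \<open>40 * n + 20 * L + 73 <= 60 * L + 73\<close> steps; 80 also covers the steps for
  sequencing.\<close>

definition time_bound :: "nat poly" where
  "time_bound = [:80, 60:] + cost_cmd reduce_all + cost unmarked_fm"

lemma wf_stability: "wfc 10 {} reduce_all" "fvc reduce_all = {}" "wff 10 {} unmarked_fm" "fv unmarked_fm = {}"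
  by (auto simp: reduce_all_def reduce_def pair_fm_def new_mark_fm_def twins_fm_def priv_fm_def unmarked_fm_def)

lemma valid_stability_code: "valid 10 stability_code"
proof -
  have "valid 10 (fill 9)" "valid 10 (rewinds 10)" by (intro valid_fill valid_rewinds; simp)+
  then show ?thesis
    using valid_code_cmd[OF wf_stability(1)] valid_code[OF wf_stability(3)]
    by (simp add: stability_code_def initialize_def)
qed

lemma wp_stability_code:
  assumes "cograph G" "graph_encoding G w"
  shows "wp stability_code (poly time_bound (length w)) (\<lambda>\<tau>. scan (\<tau> 2) = 2 \<longleftrightarrow> G \<in> alpha_stability)
    (initial_mem w)"
proof -
  obtain xs where xs: "distinct xs" "set xs = verts G" "w = adjacency_matrix G xs"
    using assms(2) unfolding graph_encoding_def by blast
  define n where "n = length xs"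
  define E where "E = (\<lambda>i j. {xs ! i, xs ! j} \<in> edges G)"
  have simple: "simple_graph G" using assms(1) by (rule cograph_imp_simple_graph)
  have n: "0 < n" using cograph_verts_nonempty[OF assms(1)] xs(2) unfolding n_def by auto
  have E: "irreflexive_graph E"
  proof
    show "E v u" if "E u v" for u v
      using that by (simp add: E_def insert_commute)
    show "\<not> E u u" for u
      using simple unfolding simple_graph_def E_def by force
  qed
  have verts: "verts G = (!) xs ` {..<n}"
    unfolding xs(2)[symmetric] n_def by (auto simp: set_conv_nth)
  have inj: "inj_on ((!) xs) {..<n}"
    using xs(1) unfolding n_def by (auto intro: inj_on_nth)
  have pairs: "\<exists>x y. twin_pair E A x y" if A: "A \<subseteq> {..<n}" "u \<in> A" "v \<in> A" "E u v" for A u v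
  proof -
    have "(!) xs ` A \<subseteq> verts G"
      unfolding verts using A(1) by (rule image_mono)
    moreover have "{xs ! u, xs ! v} \<in> edges G" using A(4) by (simp add: E_def)
    ultimately obtain x y where xy: "twin_pair (\<lambda>u v. {u, v} \<in> edges G) ((!) xs ` A) x y"
      using cograph_twin_pair[OF assms(1) _ imageI[OF A(2)] imageI[OF A(3)]] by blast
    then have "x \<in> (!) xs ` A" "y \<in> (!) xs ` A" unfolding twin_pair_def by blast+
    then obtain i j where ij: "i \<in> A" "j \<in> A" "x = xs ! i" "y = xs ! j" by blast
    have "twin_pair E A i j"
      unfolding E_def by (rule twin_pair_image[OF _ ij(1,2)]) (use xy ij(3,4) in simp)
    then show ?thesis by blast
  qed
  let ?m = "exec n E reduce_all (\<lambda>_. 0) (\<lambda>_. 1)"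
  have "G \<in> alpha_stability \<longleftrightarrow> marked_stable E {..<n} {}"
    unfolding alpha_stability_iff[OF simple] verts marked_stable_image[OF inj] E_def ..
  also have "\<dots> \<longleftrightarrow> marked n ?m = {}"
    by (rule exec_reduce_all[OF E pairs])
  also have "\<dots> \<longleftrightarrow> sat n E ?m (\<lambda>_. 0) unmarked_fm"
    by (auto simp: unmarked_fm_def marked_def)
  finally have stable: "G \<in> alpha_stability \<longleftrightarrow> sat n E ?m (\<lambda>_. 0) unmarked_fm" .
  have w: "input_tape w = matrix_tape n E 0"
    unfolding xs(3) n_def E_def by (rule input_tape_adjacency_matrix)
  have len: "length w = n * Suc n"
    unfolding xs(3) n_def by (rule length_adjacency_matrix)
  have "wp stability_code ((n * (4 * 10) + (2 * (n * Suc n) + 7) * 10 + 3) +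
      (poly (cost_cmd reduce_all) n + poly (cost unmarked_fm) n + 1) + 1)
      (decides (represents 10 n E {} (\<lambda>_. 0) ?m) (sat n E ?m (\<lambda>_. 0) unmarked_fm)) (initial_mem w)"
    unfolding stability_code_def
  proof (rule wp_Seq, rule wp_mono[OF wp_initialize[OF w n, of 10 "\<lambda>_. 0"] order_refl], simp,
      rule wp_Seq, rule wp_mono[OF wp_code_cmd[OF wf_stability(1)] order_refl])
    show "wp (code unmarked_fm) (poly (cost unmarked_fm) n)
        (decides (represents 10 n E {} (\<lambda>_. 0) ?m) (sat n E ?m (\<lambda>_. 0) unmarked_fm)) \<tau>"
      if "represents 10 n E {} (\<lambda>_. 0) ?m \<tau>" for \<tau>
      using that by (intro wp_code) (simp_all add: wf_stability)
  qed (simp_all add: wf_stability)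
  moreover have "n \<le> length w" unfolding len by simp
  then have "(n * (4 * 10) + (2 * (n * Suc n) + 7) * 10 + 3) +
      (poly (cost_cmd reduce_all) n + poly (cost unmarked_fm) n + 1) + 1 \<le> poly time_bound (length w)"
    using poly_nat_mono[of n "length w" "cost_cmd reduce_all"] poly_nat_mono[of n "length w" "cost unmarked_fm"]
    unfolding time_bound_def len[symmetric] by simp
  ultimately show ?thesis
    by (rule wp_mono) (auto simp: stable)
qed

theorem corollary13:
  "in_P_for graph_encoding {G :: nat graph. cograph G} alpha_stability"
proof -
  obtain M where M: "turing_machine M"
    "\<forall>w T b. wp stability_code T (\<lambda>\<tau>. scan (\<tau> 2) = 2 \<longleftrightarrow> b) (initial_mem w) \<longrightarrow>
       (\<forall>T'>T. if b then accepts_within M w T' else rejects_within M w T')"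
    using compile_tm[OF valid_stability_code] by (auto simp del: split_paired_All)
  \<comment> \<open>The added 1 pays for the verdict step after the program has finished.\<close>
  have "if G \<in> alpha_stability then accepts_within M w (poly (time_bound + [:1:]) (length w))
      else rejects_within M w (poly (time_bound + [:1:]) (length w))"
    if "cograph G" "graph_encoding G w" for G :: "nat graph" and w
    using M(2)[rule_format, OF wp_stability_code[OF that], of "poly (time_bound + [:1:]) (length w)"] by simp
  then show ?thesis
    unfolding in_P_for_def using M(1) by blast
qed

end
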